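(* Let $\lambda\in(1,\infty)$ and $k\ge2$ an integer, and let $G_f:=W^{k,(\lambda,\ldots,\lambda)}(\mu)$. Then there exists an $a\in G_f$ for which $\psi(a)\notin G_f$, where $\psi(a)(x):=\psi(a(x))$.
   Context: $\mathbb{N}=\{1,2,\ldots\}$. Reference measure: fix $t\in(0,2]$ and a strictly increasing function $\theta:[0,\infty)\to[0,\infty)$, twice continuously differentiable on $(0,\infty)$, with $\lim_{z\downarrow0}\theta'(z)<\infty$, $\theta(0)=0$, and $\theta(z)=c+z^t$ for all $z\ge z_t$ (with $z>0$), where $z_t\ge0$ and $c\in\mathbb{R}$ are constants; if $t\in(1,2]$, both $\theta$ and $-\sqrt{\theta}$ are also required to be convex. For $d\in\mathbb{N}$, $\mu$ is the probability measure on the Lebesgue measurable subsets of $\mathbb{R}^d$ given by $\mu(dx)=r(x)\,dx$, $r=\exp(l)$, $l(x)=\sum_{i=1}^d(C-\theta(|x_i|))$, where $C\in\mathbb{R}$ is such that $\int_{\mathbb{R}}\exp(C-\theta(|z|))\,dz=1$. Sobolev spaces: $W^{k,(\lambda,\ldots,\lambda)}(\mu)$ is the space of real-valued functions $a\in L^{\lambda}(\mu)$ having weak partial derivatives $D^sa\in L^{\lambda}(\mu)$ for all multi-indices $s$ with $1\le|s|\le k$, with norm $\big(\sum_{0\le|s|\le k}\|D^sa\|_{L^{\lambda}(\mu)}^{\lambda}\big)^{1/\lambda}$. Deformed exponential: $\psi:\mathbb{R}\to(0,\infty)$ is the inverse of the diffeomorphism $\log_d:(0,\infty)\to\mathbb{R}$,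 $\log_d y=y-1+\log y$. *)

theory Defs
  imports "HOL-Analysis.Analysis"
begin

text \<open>\<open>\<theta>\<close> is a function on \<open>[0,\<infinity>)\<close>; its values at negative arguments are irrelevant.
  The derivatives are two-sided, which is harmless since they are only taken on the open
  half-line.\<close>

definition admissible_theta :: "real \<Rightarrow> real \<Rightarrow> real \<Rightarrow> (real \<Rightarrow> real) \<Rightarrow> bool" where
  "admissible_theta t c z\<^sub>t \<theta> \<longleftrightarrow>
     (\<forall>z\<ge>0. \<theta> z \<ge> 0) \<and> strict_mono_on {0..} \<theta> \<and>
     (\<forall>z>0. \<theta> differentiable (at z) \<and> deriv \<theta> differentiable (at z)) \<and>
     continuous_on {0<..} (deriv (deriv \<theta>)) \<and>
     (\<exists>L. (deriv \<theta> \<longlongrightarrow> L) (at_right 0)) \<and>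
     \<theta> 0 = 0 \<and>
     (\<forall>z. z \<ge> z\<^sub>t \<and> z > 0 \<longrightarrow> \<theta> z = c + z powr t) \<and>
     (1 < t \<longrightarrow> convex_on {0..} \<theta> \<and> convex_on {0..} (\<lambda>z. - sqrt (\<theta> z)))"

definition log_density :: "(real \<Rightarrow> real) \<Rightarrow> real \<Rightarrow> real ^ 'd \<Rightarrow> real" where
  "log_density \<theta> C x = (\<Sum>i\<in>UNIV. C - \<theta> \<bar>x $ i\<bar>)"

definition reference_measure :: "(real \<Rightarrow> real) \<Rightarrow> real \<Rightarrow> (real ^ 'd) measure" where
  "reference_measure \<theta> C = density lebesgue (\<lambda>x. ennreal (exp (log_density \<theta> C x)))"

definition partial_deriv :: "'d \<Rightarrow> (real ^ 'd \<Rightarrow> real) \<Rightarrow> real ^ 'd \<Rightarrow> real" where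
  "partial_deriv i f = (\<lambda>x. deriv (\<lambda>h. f (x + h *\<^sub>R axis i 1)) 0)"

text \<open>\<open>iter_partial [i, j, \<dots>] f\<close> is \<open>\<partial>\<^sub>i (\<partial>\<^sub>j (\<dots> f))\<close>.\<close>

definition iter_partial :: "'d list \<Rightarrow> (real ^ 'd \<Rightarrow> real) \<Rightarrow> real ^ 'd \<Rightarrow> real" where
  "iter_partial is f = foldr partial_deriv is f"

text \<open>Differentiability (in the Frechet sense) of all iterated partial derivatives makes all of
  them continuous, so this is the usual class of infinitely differentiable functions.\<close>

definition smooth :: "(real ^ 'd \<Rightarrow> real) \<Rightarrow> bool" where
  "smooth f \<longleftrightarrow> (\<forall>is. \<forall>x. iter_partial is f differentiable (at x))"

definition test_function :: "(real ^ 'd \<Rightarrow> real) \<Rightarrow> bool" where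
  "test_function \<phi> \<longleftrightarrow> smooth \<phi> \<and> compact (closure {x. \<phi> x \<noteq> 0})"

text \<open>A multi-index is a function \<open>s\<close> on the coordinates, of order \<open>\<Sum>i. s i\<close>. The order in which
  the partial derivatives are taken is fixed arbitrarily; by symmetry of mixed partial derivatives
  it does not matter for the smooth functions to which \<open>multi_deriv\<close> is applied.\<close>

definition multi_deriv :: "('d \<Rightarrow> nat) \<Rightarrow> (real ^ 'd \<Rightarrow> real) \<Rightarrow> real ^ 'd \<Rightarrow> real" where
  "multi_deriv s f = iter_partial (SOME is. \<forall>i. count_list is i = s i) f"

definition locally_integrable :: "(real ^ 'd \<Rightarrow> real) \<Rightarrow> bool" where
  "locally_integrable f \<longleftrightarrow> (\<forall>K. compact K \<longrightarrow> set_integrable lebesgue K f)"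

definition has_weak_deriv ::
    "(real ^ 'd \<Rightarrow> real) \<Rightarrow> ('d \<Rightarrow> nat) \<Rightarrow> (real ^ 'd \<Rightarrow> real) \<Rightarrow> bool" where
  "has_weak_deriv a s v \<longleftrightarrow> locally_integrable a \<and> locally_integrable v \<and>
     (\<forall>\<phi>. test_function \<phi> \<longrightarrow>
        (LINT x|lebesgue. a x * multi_deriv s \<phi> x) =
        (-1) ^ (\<Sum>i\<in>UNIV. s i) * (LINT x|lebesgue. v x * \<phi> x))"

text \<open>Both spaces are rendered as sets of functions rather than of classes modulo null sets;
  membership is invariant under modification on a null set.\<close>

definition Lp_fun :: "real \<Rightarrow> 'a measure \<Rightarrow> ('a \<Rightarrow> real) set" where
  "Lp_fun p M = {f \<in> borel_measurable M. integrable M (\<lambda>x. \<bar>f x\<bar> powr p)}"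

definition sobolev :: "nat \<Rightarrow> real \<Rightarrow> (real ^ 'd) measure \<Rightarrow> (real ^ 'd \<Rightarrow> real) set" where
  "sobolev k p M = {a \<in> Lp_fun p M.
     \<forall>s. 1 \<le> (\<Sum>i\<in>UNIV. s i) \<and> (\<Sum>i\<in>UNIV. s i) \<le> k \<longrightarrow>
       (\<exists>v \<in> Lp_fun p M. has_weak_deriv a s v)}"

definition log_d :: "real \<Rightarrow> real" where
  "log_d y = y - 1 + ln y"

definition psi :: "real \<Rightarrow> real" where
  "psi = inv_into {0<..} log_d"

end

theory Submission
  imports Defs "HOL-Real_Asymp.Real_Asymp"
begin

text \<open>The function \<open>a\<close> depends on one coordinate only and consists of isolated spikes
  \<open>A n * spike (y - n)\<close>, where \<open>spike\<close> is smooth with support in \<open>[0,1]\<close> and crosses zero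
  transversally at \<open>1 / 2\<close>. The \<open>p\<close>-th powers of the norms of all its derivatives are of order
  \<open>A n powr p * w n\<close>, with \<open>w\<close> the weight. But \<open>\<psi> \<circ> a\<close> turns a corner at the zero crossing: its second
  derivative contains \<open>\<psi>'' (a) * a'\<^sup>2\<close>, which is of order \<open>(A n)\<^sup>2\<close> on an interval of length of order
  \<open>1 / A n\<close>, so the \<open>p\<close>-th power of its norm is at least of order \<open>A n powr (2 * p - 1) * w n\<close>.
  As \<open>2 * p - 1 > p\<close> and \<open>w\<close> decays faster than any power, \<open>A\<close> can be chosen such that the first
  quantity is summable and the second one unbounded.\<close>

subsection \<open>Smooth functions on the line\<close>

text \<open>The first two derivatives of \<open>psi\<close> lie between 0 and 1, so the composition
  causes no harm at order one; the trouble starts at order two, with the square of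
  \<open>a'\<close>. As \<open>psi''\<close> decays like an inverse square at plus infinity and
  exponentially at minus infinity, that square is felt only where \<open>a\<close> is of order one.
  Hence the steep zero crossing inside each spike.

  On the cell from n to n + 1 the weight lies between w(n + 1) and w(n). The norm of
  \<open>a\<close> is therefore estimated with w(n), the blow-up with w(n + 1). The heights solve
  A(n)^p * w(n) = (n + 1)^(-2). This turns A(n)^(2p - 1) * w(n + 1) into exp((1 + e) * n^t - (n +
  1)^t) up to powers of n and constants, where e = (p - 1) / p. The loss (n + 1)^t - n^t between the
  two ends of a cell is of smaller order than e * n^t.

  Nonmembership has to refute every candidate \<open>v\<close> for the weak derivative, not only the
  classical second derivative. A test function concentrated on the crossing of one spike transfers
  the lower bound directly to the norm of \<open>v\<close>, without an appeal to uniqueness of weak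
  derivatives.\<close>

primrec nth_differentiable :: "nat \<Rightarrow> (real \<Rightarrow> real) \<Rightarrow> bool" where
  "nth_differentiable 0 f \<longleftrightarrow> True"
| "nth_differentiable (Suc n) f \<longleftrightarrow>
     (\<forall>x. f differentiable (at x)) \<and> nth_differentiable n (deriv f)"

definition smooth_real :: "(real \<Rightarrow> real) \<Rightarrow> bool" where
  "smooth_real f \<longleftrightarrow> (\<forall>n. nth_differentiable n f)"

lemma nth_differentiable_SucI:
  assumes "\<And>x. (f has_real_derivative f' x) (at x)" "nth_differentiable n f'"
  shows "nth_differentiable (Suc n) f"
proof -
  have "deriv f = f'"
    using assms(1) DERIV_imp_deriv by blast
  then show ?thesis
    using assms real_differentiable_def by auto
qed

lemma nth_differentiable_SucD:
  assumes "nth_differentiable (Suc n) f"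
  shows "(f has_real_derivative deriv f x) (at x)" "nth_differentiable n (deriv f)"
  using assms by (auto simp: DERIV_deriv_iff_real_differentiable)

lemma nth_differentiable_lower: "nth_differentiable (Suc n) f \<Longrightarrow> nth_differentiable n f"
  by (induction n arbitrary: f) auto

lemma nth_differentiable_const: "nth_differentiable n (\<lambda>x. a)"
proof (induction n arbitrary: a)
  case (Suc n)
  show ?case
    by (rule nth_differentiable_SucI[where f' = "\<lambda>x. 0"]) (use Suc in auto)
qed auto

lemma nth_differentiable_add:
  "nth_differentiable n f \<Longrightarrow> nth_differentiable n g \<Longrightarrow> nth_differentiable n (\<lambda>x. f x + g x)"
proof (induction n arbitrary: f g)
  case (Suc n)
  show ?case
    by (rule nth_differentiable_SucI[where f' = "\<lambda>x. deriv f x + deriv g x"])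
      (use Suc nth_differentiable_SucD in \<open>auto intro!: DERIV_add simp del: nth_differentiable.simps\<close>)
qed auto

lemma nth_differentiable_mult:
  "nth_differentiable n f \<Longrightarrow> nth_differentiable n g \<Longrightarrow> nth_differentiable n (\<lambda>x. f x * g x)"
proof (induction n arbitrary: f g)
  case (Suc n)
  show ?case
  proof (rule nth_differentiable_SucI[where f' = "\<lambda>x. deriv f x * g x + deriv g x * f x"])
    show "((\<lambda>x. f x * g x) has_real_derivative deriv f x * g x + deriv g x * f x) (at x)" for x
      using Suc.prems nth_differentiable_SucD(1) by (intro DERIV_mult) blast+
    show "nth_differentiable n (\<lambda>x. deriv f x * g x + deriv g x * f x)"
      using Suc.prems nth_differentiable_SucD(2) nth_differentiable_lower
      by (intro nth_differentiable_add Suc.IH) blast+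
  qed
qed auto

lemma nth_differentiable_affine:
  "nth_differentiable n f \<Longrightarrow> nth_differentiable n (\<lambda>x. f (a * x + b))"
proof (induction n arbitrary: f)
  case (Suc n)
  show ?case
  proof (rule nth_differentiable_SucI[where f' = "\<lambda>x. deriv f (a * x + b) * a"])
    show "((\<lambda>x. f (a * x + b)) has_real_derivative deriv f (a * x + b) * a) (at x)" for x
      by (rule DERIV_chain2[of f], rule nth_differentiable_SucD[OF Suc.prems])
         (auto intro!: derivative_eq_intros)
    show "nth_differentiable n (\<lambda>x. deriv f (a * x + b) * a)"
      using Suc by (intro nth_differentiable_mult nth_differentiable_const) auto
  qed
qed auto

lemma nth_differentiable_ident: "nth_differentiable n (\<lambda>x. x)"
  by (cases n) (auto intro!: nth_differentiable_SucI[where f' = "\<lambda>x. 1"] nth_differentiable_const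
      simp del: nth_differentiable.simps(2))

lemma smooth_real_mult: "smooth_real f \<Longrightarrow> smooth_real g \<Longrightarrow> smooth_real (\<lambda>x. f x * g x)"
  and smooth_real_affine: "smooth_real f \<Longrightarrow> smooth_real (\<lambda>x. f (a * x + b))"
  and smooth_real_ident: "smooth_real (\<lambda>x. x)"
  by (auto simp: smooth_real_def nth_differentiable_mult nth_differentiable_affine
      nth_differentiable_ident)

lemma smooth_real_derivative:
  assumes "smooth_real f"
  shows "(f has_real_derivative deriv f x) (at x)" "smooth_real (deriv f)"
  using assms nth_differentiable_SucD unfolding smooth_real_def by blast+

lemma smooth_real_funpow_deriv: "smooth_real f \<Longrightarrow> smooth_real ((deriv ^^ n) f)"
  by (induction n) (auto intro: smooth_real_derivative)

lemma smooth_real_continuous: "smooth_real f \<Longrightarrow> continuous_on S f"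
  by (meson DERIV_isCont continuous_at_imp_continuous_on smooth_real_derivative(1))

text \<open>The factors \<open>x ^ k\<close> make the family closed under differentiation up to linear combinations,
  which yields smoothness at \<open>0\<close>.\<close>

definition flat_exp :: "nat \<Rightarrow> real \<Rightarrow> real" where
  "flat_exp k x = (if x > 0 then exp (- 1 / x) / x ^ k else 0)"

lemma flat_exp_tendsto_0: "(flat_exp k \<longlongrightarrow> 0) (at 0)"
proof -
  have "((\<lambda>s. s ^ k / exp s) \<longlongrightarrow> (0::real)) at_top"
    by (rule tendsto_power_div_exp_0)
  then have "((\<lambda>x. inverse x ^ k / exp (inverse x)) \<longlongrightarrow> (0::real)) (at_right 0)"
    by (rule filterlim_compose) (rule filterlim_inverse_at_top_right)
  then have "(flat_exp k \<longlongrightarrow> 0) (at_right 0)"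
    by (rule filterlim_cong[THEN iffD1, rotated -1])
       (auto simp: eventually_at_filter flat_exp_def exp_minus field_simps)
  moreover have "(flat_exp k \<longlongrightarrow> 0) (at_left 0)"
    by (rule filterlim_cong[THEN iffD1, rotated -1, OF tendsto_const])
       (auto simp: eventually_at_filter flat_exp_def)
  ultimately show ?thesis
    using filterlim_split_at by blast
qed

lemma flat_exp_derivative:
  "(flat_exp k has_real_derivative flat_exp (k + 2) x - of_nat k * flat_exp (k + 1) x) (at x)"
proof -
  consider "x > 0" | "x < 0" | "x = 0" by linarith
  then show ?thesis
  proof cases
    case 1
    have "((\<lambda>x. exp (- 1 / x) / x ^ k) has_real_derivative
        flat_exp (k + 2) x - of_nat k * flat_exp (k + 1) x) (at x)"
      using 1
      by (auto intro!: derivative_eq_intros simp: flat_exp_def power2_eq_square)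
        (cases k; simp add: field_simps power2_eq_square)
    then show ?thesis
      by (rule has_field_derivative_transform_within_open[where S = "{0<..}"])
         (use 1 in \<open>auto simp: flat_exp_def\<close>)
  next
    case 2
    have "((\<lambda>x. 0) has_real_derivative
        flat_exp (k + 2) x - of_nat k * flat_exp (k + 1) x) (at x)"
      using 2 by (auto simp: flat_exp_def)
    then show ?thesis
      by (rule has_field_derivative_transform_within_open[where S = "{..<0}"])
         (use 2 in \<open>auto simp: flat_exp_def\<close>)
  next
    case 3
    \<comment> \<open>The difference quotient at 0 is again a member of the family, so the limit
      already computed is the derivative.\<close>
    have "flat_exp k h / h = flat_exp (Suc k) h" for h
      by (auto simp: flat_exp_def)
    then show ?thesis
      using 3 flat_exp_tendsto_0[of "Suc k"]
      by (auto simp: DERIV_def flat_exp_def[of _ 0])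
  qed
qed

lemma nth_differentiable_flat_exp: "nth_differentiable n (flat_exp k)"
proof (induction n arbitrary: k)
  case (Suc n)
  have "nth_differentiable n (\<lambda>x. flat_exp (k + 2) x + (- of_nat k) * flat_exp (k + 1) x)"
    by (intro nth_differentiable_add nth_differentiable_mult nth_differentiable_const Suc)
  then show ?case
    by (intro nth_differentiable_SucI[OF flat_exp_derivative]) simp
qed simp

section \<open>A smooth bump on the unit interval\<close>

definition bump :: "real \<Rightarrow> real" where
  "bump x = flat_exp 0 x * flat_exp 0 (1 - x)"

lemma smooth_real_bump: "smooth_real bump"
proof -
  have "smooth_real (\<lambda>x. flat_exp 0 x * flat_exp 0 ((-1) * x + 1))"
    using nth_differentiable_flat_exp
    by (intro smooth_real_mult smooth_real_affine) (auto simp: smooth_real_def)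
  then show ?thesis
    by (simp add: bump_def[abs_def])
qed

lemma bump_eq_0: "x \<le> 0 \<or> 1 \<le> x \<Longrightarrow> bump x = 0"
  and bump_pos: "0 < x \<Longrightarrow> x < 1 \<Longrightarrow> bump x > 0"
  and bump_nonneg: "bump x \<ge> 0"
  by (auto simp: bump_def flat_exp_def)

lemma bump_le_1: "bump x \<le> 1"
proof -
  have "0 \<le> flat_exp 0 y" "flat_exp 0 y \<le> 1" for y
    by (auto simp: flat_exp_def)
  then show ?thesis
    unfolding bump_def by (meson mult_le_one)
qed

lemma integral_bump: "integrable lborel bump" "integral\<^sup>L lborel bump > 0"
proof -
  have "integrable lborel (\<lambda>x. indicator {0..1} x *\<^sub>R bump x)"
    by (intro borel_integrable_compact smooth_real_continuous smooth_real_bump) auto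
  moreover have "(\<lambda>x. indicator {0..1} x *\<^sub>R bump x) = bump"
    by (rule ext) (use bump_eq_0 linear in \<open>force simp: indicator_def\<close>)
  ultimately show i: "integrable lborel bump"
    by metis
  have "integral\<^sup>L lborel bump \<noteq> 0"
  proof
    assume "integral\<^sup>L lborel bump = 0"
    then have "AE x in lborel. bump x = 0"
      using i bump_nonneg integral_nonneg_eq_0_iff_AE by blast
    then have "AE x in lborel. x \<notin> {0<..<1::real}"
      by eventually_elim (use bump_pos in force)
    then have "{0<..<1::real} \<in> null_sets lborel"
      by (auto simp: AE_iff_null_sets)
    then show False
      by (auto simp: null_sets_def)
  qed
  then show "integral\<^sup>L lborel bump > 0"
    using Bochner_Integration.integral_nonneg[of lborel bump, OF bump_nonneg]
    by (simp add: order.strict_iff_order)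
qed

text \<open>For \<open>x < 0\<close> the term selected is \<open>n = 0\<close>, which vanishes for the profiles \<open>f\<close> used here.\<close>

definition spike_train :: "(nat \<Rightarrow> real) \<Rightarrow> (real \<Rightarrow> real) \<Rightarrow> real \<Rightarrow> real" where
  "spike_train A f x = A (nat \<lfloor>x\<rfloor>) * f (x - real (nat \<lfloor>x\<rfloor>))"

text \<open>Only the term with n equal to the floor of x can be nonzero. The finite sum has the same
  summands on the whole open set \<open>{..<real N}\<close>, which permits termwise differentiation
  across the integers, where the floor jumps.\<close>

lemma spike_train_eq_sum:
  assumes "\<And>x. x \<le> 0 \<or> 1 \<le> x \<Longrightarrow> f x = 0" "x < real N"
  shows "spike_train A f x = (\<Sum>n<N. A n * f (x - real n))"
proof -
  let ?m = "nat \<lfloor>x\<rfloor>"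
  have *: "f (x - real n) = 0" if "n \<noteq> ?m" for n
    using that by (intro assms(1)) linarith
  show ?thesis
  proof (cases "?m < N")
    case True
    have "(\<Sum>n<N. A n * f (x - real n)) = (\<Sum>n\<in>{?m}. A n * f (x - real n))"
      by (rule sum.mono_neutral_right) (use True * in auto)
    then show ?thesis by (simp add: spike_train_def)
  next
    \<comment> \<open>This happens only for negative x and an empty sum: \<open>nat\<close> sends
      the negative floor to 0, which is not below \<open>N = 0\<close>.\<close>
    case False
    then have "x \<le> 0" "N = 0" using assms(2) by linarith+
    then show ?thesis using assms(1)[of x] by (auto simp: spike_train_def)
  qed
qed

lemma spike_train_derivative:
  assumes "\<And>x. x \<le> 0 \<or> 1 \<le> x \<Longrightarrow> f x = 0" "\<And>x. x \<le> 0 \<or> 1 \<le> x \<Longrightarrow> f' x = 0"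
    and "\<And>x. (f has_real_derivative f' x) (at x)"
  shows "(spike_train A f has_real_derivative spike_train A f' x) (at x)"
proof -
  obtain N where N: "x < real N" using reals_Archimedean2 by blast
  have "((\<lambda>x. \<Sum>n<N. A n * f (x - real n)) has_real_derivative
     (\<Sum>n<N. A n * f' (x - real n))) (at x)"
    by (rule DERIV_sum) (auto intro!: derivative_eq_intros DERIV_chain2[OF assms(3)])
  then have "((\<lambda>x. \<Sum>n<N. A n * f (x - real n)) has_real_derivative spike_train A f' x) (at x)"
    using spike_train_eq_sum[OF assms(2) N] by simp
  then show ?thesis
    by (rule has_field_derivative_transform_within_open[where S = "{..<real N}"])
       (use N spike_train_eq_sum[OF assms(1)] in auto)
qed

text \<open>At the endpoints 0 and 1 the function is known to vanish on one side only. The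
  derivative is therefore computed off the closed interval and extended to the endpoints by its
  continuity.\<close>

lemma deriv_vanish_outside:
  fixes f :: "real \<Rightarrow> real"
  assumes f: "smooth_real f" and "\<And>x. x \<le> 0 \<or> 1 \<le> x \<Longrightarrow> f x = 0" "x \<le> 0 \<or> 1 \<le> x"
  shows "deriv f x = 0"
proof -
  have "deriv f x = 0" if "x < 0 \<or> 1 < x" for x
  proof -
    have "((\<lambda>x. 0) has_real_derivative 0) (at x)" by simp
    then have "(f has_real_derivative 0) (at x)"
      by (rule has_field_derivative_transform_within_open[where S = "{..<0} \<union> {1<..}"])
         (use that assms(2) in force)+
    then show ?thesis by (rule DERIV_imp_deriv)
  qed
  moreover have "continuous_on (closure ({..<0} \<union> {1<..})) (deriv f)"
    by (rule smooth_real_continuous[OF smooth_real_derivative(2)[OF f]])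
  ultimately have "deriv f y = 0" if "y \<in> closure ({..<0} \<union> {1<..})" for y
    using continuous_constant_on_closure[of "{..<0} \<union> {1<..}" "deriv f" 0 y] that by blast
  then show ?thesis using assms(3) by auto
qed

lemma funpow_deriv_vanish_outside:
  assumes "smooth_real f" and "\<And>x. x \<le> 0 \<or> 1 \<le> x \<Longrightarrow> f x = 0" "x \<le> 0 \<or> 1 \<le> x"
  shows "(deriv ^^ n) f x = 0"
  using assms(3)
proof (induction n arbitrary: x)
  case (Suc n)
  then show ?case
    using deriv_vanish_outside[OF smooth_real_funpow_deriv[OF assms(1), of n]] by simp
qed (use assms in auto)

lemma smooth_unit_support_bounded:
  assumes "smooth_real f" and "\<And>x. x \<le> 0 \<or> 1 \<le> x \<Longrightarrow> f x = 0"
  obtains B where "\<And>x. \<bar>f x\<bar> \<le> B"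
proof -
  have "bounded (f ` {0..1})"
    using assms by (intro compact_imp_bounded compact_continuous_image smooth_real_continuous) auto
  then obtain B where B: "\<And>x. x \<in> {0..1} \<Longrightarrow> \<bar>f x\<bar> \<le> B"
    unfolding bounded_iff real_norm_def by blast
  have "\<bar>f x\<bar> \<le> B" for x
    using B[of x] B[of 0] assms(2)[of x] by fastforce
  then show ?thesis by (rule that)
qed

subsection \<open>Integration by parts against test functions\<close>

text \<open>Relational form of \<open>partial_deriv\<close>: it also asserts that the derivative
  exists, which an equation with \<open>deriv\<close> does not.\<close>

definition has_partial_deriv ::
    "'d \<Rightarrow> (real ^ 'd \<Rightarrow> real) \<Rightarrow> (real ^ 'd \<Rightarrow> real) \<Rightarrow> bool" where
  "has_partial_deriv i f f' \<longleftrightarrow>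
     (\<forall>x. ((\<lambda>h. f (x + h *\<^sub>R axis i 1)) has_real_derivative f' x) (at 0))"

lemma has_partial_deriv_imp_eq: "has_partial_deriv i f f' \<Longrightarrow> partial_deriv i f = f'"
  by (auto simp: has_partial_deriv_def partial_deriv_def DERIV_imp_deriv)

lemma has_partial_deriv_mult:
  fixes f g :: "real ^ 'd \<Rightarrow> real"
  assumes "has_partial_deriv i f f'" "has_partial_deriv i g g'"
  shows "has_partial_deriv i (\<lambda>x. f x * g x) (\<lambda>x. f' x * g x + f x * g' x)"
  unfolding has_partial_deriv_def
proof
  fix x :: "real ^ 'd"
  show "((\<lambda>h. f (x + h *\<^sub>R axis i 1) * g (x + h *\<^sub>R axis i 1)) has_real_derivative
          f' x * g x + f x * g' x) (at 0)"
    using DERIV_mult[OF assms(1)[unfolded has_partial_deriv_def, rule_format, of x]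
        assms(2)[unfolded has_partial_deriv_def, rule_format, of x]]
    by (simp add: mult.commute)
qed

lemma has_partial_deriv_coordinate:
  fixes i j :: "'d::finite"
  assumes "\<And>x. (f has_real_derivative f' x) (at x)"
  shows "has_partial_deriv j (\<lambda>x. f (x $ i)) (\<lambda>x. if j = i then f' (x $ i) else 0)"
  unfolding has_partial_deriv_def
proof
  fix x
  have "((\<lambda>h. f (x $ i + h)) has_real_derivative f' (x $ i)) (at 0)"
    using assms[of "x $ i"] DERIV_shift[of f "f' (x $ i)" 0 "x $ i"] by (simp add: add.commute)
  then show "((\<lambda>h. f ((x + h *\<^sub>R axis j 1) $ i)) has_real_derivative
      (if j = i then f' (x $ i) else 0)) (at 0)"
    by (auto simp: axis_def)
qed

lemma has_partial_deriv_of_differentiable: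
  fixes f :: "real ^ 'd \<Rightarrow> real"
  assumes "\<And>x. f differentiable (at x)"
  shows "has_partial_deriv i f (partial_deriv i f)"
  unfolding has_partial_deriv_def
proof
  fix x :: "real ^ 'd"
  have "(\<lambda>h. f (x + h *\<^sub>R axis i 1)) differentiable (at 0)"
    using differentiable_chain_at[of "\<lambda>h. x + h *\<^sub>R axis i 1" 0 f] assms by (simp add: o_def)
  then show "((\<lambda>h. f (x + h *\<^sub>R axis i 1)) has_real_derivative partial_deriv i f x) (at 0)"
    unfolding partial_deriv_def by (simp add: DERIV_deriv_iff_real_differentiable)
qed

lemma has_partial_deriv_line:
  assumes "has_partial_deriv i f f'"
  shows "((\<lambda>s. f (x + s *\<^sub>R axis i 1)) has_real_derivative f' (x + t *\<^sub>R axis i 1)) (at t)"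
proof -
  have "((\<lambda>h. f (x + t *\<^sub>R axis i 1 + h *\<^sub>R axis i 1)) has_real_derivative
      f' (x + t *\<^sub>R axis i 1)) (at 0)"
    using assms unfolding has_partial_deriv_def by blast
  moreover have "x + t *\<^sub>R axis i 1 + h *\<^sub>R axis i 1 = x + (h + t) *\<^sub>R axis i 1" for h
    by (simp add: algebra_simps)
  ultimately show ?thesis
    using DERIV_shift[of "\<lambda>s. f (x + s *\<^sub>R axis i 1)" "f' (x + t *\<^sub>R axis i 1)" 0 t] by simp
qed

lemma has_partial_deriv_vanish:
  assumes "has_partial_deriv i f f'" "closed K" "\<And>x. x \<notin> K \<Longrightarrow> f x = 0" "x \<notin> K"
  shows "f' x = 0"
proof -
  let ?S = "(\<lambda>h. x + h *\<^sub>R axis i 1) -` (- K)"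
  have "open ?S"
    using assms(2) by (intro continuous_open_vimage) (auto intro!: continuous_intros)
  moreover have "((\<lambda>h. f (x + h *\<^sub>R axis i 1)) has_real_derivative f' x) (at 0)"
    using assms(1) unfolding has_partial_deriv_def by blast
  ultimately have "((\<lambda>h. 0) has_real_derivative f' x) (at 0)"
    using assms(3,4) by (elim has_field_derivative_transform_within_open[where S = ?S, rotated]) auto
  then show ?thesis
    by (rule DERIV_unique) simp
qed

lemma integrable_compact_support:
  fixes f :: "'a::euclidean_space \<Rightarrow> real"
  assumes "continuous_on UNIV f" "compact K" "\<And>x. x \<notin> K \<Longrightarrow> f x = 0"
  shows "integrable lborel f"
proof -
  have "integrable lborel (\<lambda>x. indicator K x *\<^sub>R f x)"
    by (intro borel_integrable_compact assms(2) continuous_on_subset[OF assms(1)]) auto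
  moreover have "(\<lambda>x. indicator K x *\<^sub>R f x) = f"
    using assms(3) by (force simp: indicator_def)
  ultimately show ?thesis by metis
qed

lemma integral_lborel_translate:
  fixes f :: "'a::euclidean_space \<Rightarrow> real"
  assumes "f \<in> borel_measurable borel"
  shows "(\<integral>x. f (x + c) \<partial>lborel) = integral\<^sup>L lborel f"
proof -
  have "integral\<^sup>L lborel f = integral\<^sup>L (distr lborel borel ((+) c)) f"
    by (simp add: lborel_distr_plus)
  also have "\<dots> = (\<integral>x. f (c + x) \<partial>lborel)"
    using assms by (intro integral_distr) auto
  finally show ?thesis by (simp add: add.commute)
qed

text \<open>The difference quotients have integral zero by translation invariance; let the step
  tend to zero.\<close>

lemma integral_partial_deriv_eq_0:
  fixes f :: "real ^ 'd \<Rightarrow> real"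
  assumes f: "has_partial_deriv i f f'" "continuous_on UNIV f" "continuous_on UNIV f'"
    and K: "compact K" "\<And>x. x \<notin> K \<Longrightarrow> f x = 0"
  shows "integral\<^sup>L lborel f' = 0"
proof -
  let ?e = "axis i 1 :: real ^ 'd"
  have f'K: "f' x = 0" if "x \<notin> K" for x
    using has_partial_deriv_vanish[OF f(1) compact_imp_closed[OF K(1)] K(2)] that by blast
  have "bounded (f' ` K)"
    using f(3) K(1) continuous_on_subset by (intro compact_imp_bounded compact_continuous_image) auto
  then obtain B where B: "B > 0" "\<And>x. x \<in> K \<Longrightarrow> \<bar>f' x\<bar> \<le> B"
    unfolding bounded_pos real_norm_def by blast
  have B': "\<bar>f' x\<bar> \<le> B" for x
    using B f'K by (cases "x \<in> K") auto
  obtain R where R: "\<And>x. x \<in> K \<Longrightarrow> norm x \<le> R"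
    using compact_imp_bounded[OF K(1)] unfolding bounded_iff by blast
  define q where "q n x = (f (x + inverse (real (Suc n)) *\<^sub>R ?e) - f x) * real (Suc n)" for n x
  have f_int: "integrable lborel f"
    by (rule integrable_compact_support[OF f(2) K])
  have [measurable]: "f \<in> borel_measurable borel" "f' \<in> borel_measurable borel"
    using f by (auto intro: borel_measurable_continuous_onI)
  have q0: "integral\<^sup>L lborel (q n) = 0" for n
  proof -
    let ?c = "inverse (real (Suc n)) *\<^sub>R ?e"
    have "integrable lborel (\<lambda>x. f (x + ?c))"
    proof (rule integrable_compact_support)
      show "continuous_on UNIV (\<lambda>x. f (x + ?c))"
        by (rule continuous_on_compose2[OF f(2)]) (auto intro!: continuous_intros)
      show "compact ((+) (- ?c) ` K)"
        by (rule compact_translation[OF K(1)])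
      show "f (x + ?c) = 0" if "x \<notin> (+) (- ?c) ` K" for x
      proof (rule K(2))
        show "x + ?c \<notin> K"
        proof
          assume "x + ?c \<in> K"
          then have "- ?c + (x + ?c) \<in> (+) (- ?c) ` K" by (rule imageI)
          then show False using that by simp
        qed
      qed
    qed
    then show ?thesis
      unfolding q_def using f_int integral_lborel_translate[of f ?c] by simp
  qed
  have lim: "(\<lambda>n. q n x) \<longlonglongrightarrow> f' x" for x
  proof -
    have "((\<lambda>h. (f (x + h *\<^sub>R ?e) - f x) / h) \<longlongrightarrow> f' x) (at 0)"
      using f(1) unfolding has_partial_deriv_def DERIV_def by simp
    moreover have "filterlim (\<lambda>n. inverse (real (Suc n))) (at 0) sequentially"
      using LIMSEQ_inverse_real_of_nat by (auto simp: filterlim_at)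
    ultimately have "(\<lambda>n. (f (x + inverse (real (Suc n)) *\<^sub>R ?e) - f x) / inverse (real (Suc n)))
        \<longlonglongrightarrow> f' x"
      by (rule filterlim_compose)
    then show ?thesis
      by (simp add: q_def field_simps)
  qed
  \<comment> \<open>A dominating function: the mean value theorem bounds each quotient by
    \<open>B\<close>, and since the steps have length at most 1, all quotients vanish off the ball
    of radius \<open>R + 1\<close>.\<close>
  have bound: "norm (q n x) \<le> B * indicator (cball 0 (R + 1)) x" for n x
  proof (cases "norm x \<le> R + 1")
    case True
    let ?h = "inverse (real (Suc n))"
    have "norm (f (x + ?h *\<^sub>R ?e) - f (x + 0 *\<^sub>R ?e)) \<le> B * norm (?h - 0)"
      using B' has_partial_deriv_line[OF f(1), of x]
      by (intro field_differentiable_bound[where S = UNIV and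
            f' = "\<lambda>t. f' (x + t *\<^sub>R ?e)"]) auto
    then have "\<bar>f (x + ?h *\<^sub>R ?e) - f x\<bar> * real (Suc n) \<le> B * ?h * real (Suc n)"
      by (intro mult_right_mono) auto
    also have "\<dots> = B" by simp
    finally show ?thesis
      using True by (simp add: q_def abs_mult del: of_nat_Suc)
  next
    case False
    have "norm (inverse (real (Suc n)) *\<^sub>R ?e) \<le> 1"
      by (simp add: inverse_eq_divide)
    then have "norm (x + inverse (real (Suc n)) *\<^sub>R ?e) > R"
      using False norm_triangle_ineq4[of "x + inverse (real (Suc n)) *\<^sub>R ?e"
          "inverse (real (Suc n)) *\<^sub>R ?e"] by simp
    then have "f (x + inverse (real (Suc n)) *\<^sub>R ?e) = 0" "f x = 0"
      using R K(2) False by (force, force)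
    then show ?thesis
      using False by (simp add: q_def)
  qed
  have "(\<lambda>n. integral\<^sup>L lborel (q n)) \<longlonglongrightarrow> integral\<^sup>L lborel f'"
  proof (rule integral_dominated_convergence)
    show "integrable lborel (\<lambda>x::real^'d. B * indicator (cball 0 (R + 1)) x)"
      by (intro integrable_mult_right integrable_real_indicator
          emeasure_bounded_finite bounded_cball) auto
    show "q n \<in> borel_measurable lborel" for n
      unfolding q_def by measurable
  qed (use lim bound in auto)
  then show ?thesis
    by (simp add: q0 LIMSEQ_const_iff)
qed

section \<open>Test functions and weak derivatives\<close>

lemma test_functionD:
  assumes "test_function \<phi>"
  shows "\<phi> differentiable (at x)" "continuous_on S \<phi>"
    "compact (closure {x. \<phi> x \<noteq> 0})"
proof -
  have "iter_partial [] \<phi> differentiable (at x)" for x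
    using assms unfolding test_function_def smooth_def by blast
  then show *: "\<phi> differentiable (at x)" for x
    by (simp add: iter_partial_def)
  show "continuous_on S \<phi>"
    by (meson * differentiable_at_withinI differentiable_imp_continuous_on differentiable_on_def)
qed (use assms test_function_def in blast)

lemma outside_support: "x \<notin> closure {x. \<phi> x \<noteq> 0} \<Longrightarrow> \<phi> x = 0"
  using closure_subset[of "{x. \<phi> x \<noteq> 0}"] by blast

lemma test_function_partial:
  assumes "test_function \<phi>"
  shows "has_partial_deriv i \<phi> (partial_deriv i \<phi>)" "test_function (partial_deriv i \<phi>)"
proof -
  show *: "has_partial_deriv i \<phi> (partial_deriv i \<phi>)"
    by (rule has_partial_deriv_of_differentiable) (rule test_functionD[OF assms])
  have "iter_partial is (partial_deriv i \<phi>) = iter_partial (is @ [i]) \<phi>" for "is"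
    by (simp add: iter_partial_def)
  then have "smooth (partial_deriv i \<phi>)"
    using assms unfolding test_function_def smooth_def by simp
  moreover have "closure {x. partial_deriv i \<phi> x \<noteq> 0} \<subseteq> closure {x. \<phi> x \<noteq> 0}"
    using has_partial_deriv_vanish[OF * closed_closure outside_support[of _ \<phi>]]
    by (intro closure_minimal) auto
  then have "compact (closure {x. partial_deriv i \<phi> x \<noteq> 0})"
    using compact_Int_closed[OF test_functionD(3)[OF assms], of "closure {x. partial_deriv i \<phi> x \<noteq> 0}"]
    by (simp add: Int_absorb1)
  ultimately show "test_function (partial_deriv i \<phi>)"
    by (simp add: test_function_def)
qed

lemma test_function_iter_partial:
  "test_function \<phi> \<Longrightarrow> test_function (iter_partial is \<phi>)"
  by (induction "is") (auto simp: iter_partial_def test_function_partial)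

lemma integrable_mult_test:
  assumes "continuous_on UNIV f" "test_function \<phi>"
  shows "integrable lborel (\<lambda>x. f x * \<phi> x)"
proof (rule integrable_compact_support)
  show "continuous_on UNIV (\<lambda>x. f x * \<phi> x)"
    by (intro continuous_on_mult assms(1) test_functionD[OF assms(2)])
  show "compact (closure {x. \<phi> x \<noteq> 0})"
    by (rule test_functionD[OF assms(2)])
  show "f x * \<phi> x = 0" if "x \<notin> closure {x. \<phi> x \<noteq> 0}" for x
    using outside_support[OF that] by simp
qed

lemma integral_by_parts_test:
  assumes f: "has_partial_deriv i f f'" "continuous_on UNIV f" "continuous_on UNIV f'"
    and \<phi>: "test_function \<phi>"
  shows "(\<integral>x. f x * partial_deriv i \<phi> x \<partial>lborel) = - (\<integral>x. f' x * \<phi> x \<partial>lborel)"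
proof -
  note \<phi>' = test_function_partial[OF \<phi>, of i]
  have "(\<integral>x. f' x * \<phi> x + f x * partial_deriv i \<phi> x \<partial>lborel) = 0"
  proof (rule integral_partial_deriv_eq_0[OF has_partial_deriv_mult[OF f(1) \<phi>'(1)],
        where K = "closure {x. \<phi> x \<noteq> 0}"])
    show "f x * \<phi> x = 0" if "x \<notin> closure {x. \<phi> x \<noteq> 0}" for x
      using outside_support[of x \<phi>] that by simp
    show "continuous_on UNIV (\<lambda>x. f' x * \<phi> x + f x * partial_deriv i \<phi> x)"
      by (intro continuous_on_add continuous_on_mult f test_functionD[OF \<phi>] test_functionD[OF \<phi>'(2)])
    show "continuous_on UNIV (\<lambda>x. f x * \<phi> x)"
      by (intro continuous_on_mult f test_functionD[OF \<phi>])
    show "compact (closure {x. \<phi> x \<noteq> 0})"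
      by (rule test_functionD[OF \<phi>])
  qed
  then show ?thesis
    using integrable_mult_test[OF f(3) \<phi>] integrable_mult_test[OF f(2) \<phi>'(2)] by simp
qed

text \<open>\<open>G\<close> is a chain of successive derivatives. Each integration by parts moves
  the outermost partial derivative from the test function to the chain, raising \<open>n\<close> by
  one, or produces zero if its direction is not \<open>i\<close>. Only the last member has to be
  assumed continuous, so the statement covers the spike trains for every \<open>N\<close> as well as
  the chain \<open>psi_spikes\<close>, which stops at 2.\<close>

lemma integral_iter_partial_coordinate:
  fixes G :: "nat \<Rightarrow> real \<Rightarrow> real"
  assumes "\<And>m x. m < N \<Longrightarrow> (G m has_real_derivative G (Suc m) x) (at x)"
    and "continuous_on UNIV (G N)" "test_function \<phi>" "n + length is \<le> N"
  shows "(\<integral>x. G n (x $ i) * iter_partial is \<phi> x \<partial>lborel) = (-1) ^ length is *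
     (\<integral>x. (if set is \<subseteq> {i} then G (n + length is) (x $ i) else 0) * \<phi> x \<partial>lborel)"
  using assms(4)
proof (induction "is" arbitrary: n)
  case Nil
  then show ?case by (simp add: iter_partial_def)
next
  case (Cons j js)
  have cont: "continuous_on UNIV (\<lambda>x. G m (x $ i))" if "m \<le> N" for m
  proof -
    have "continuous_on UNIV (G m)"
      using that assms(1)[of m] assms(2) DERIV_isCont
      by (cases "m = N") (auto intro!: continuous_at_imp_continuous_on)
    then show ?thesis
      by (rule continuous_on_compose2) (auto intro!: continuous_intros)
  qed
  have "(\<integral>x. G n (x $ i) * iter_partial (j # js) \<phi> x \<partial>lborel) =
      (\<integral>x. G n (x $ i) * partial_deriv j (iter_partial js \<phi>) x \<partial>lborel)"
    by (simp add: iter_partial_def)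
  also have "\<dots> = - (\<integral>x. (if j = i then G (Suc n) (x $ i) else 0) * iter_partial js \<phi> x \<partial>lborel)"
    using Cons.prems cont[of n] cont[of "Suc n"]
    by (intro integral_by_parts_test has_partial_deriv_coordinate
        test_function_iter_partial assms) (cases "j = i"; simp)+
  also have "\<dots> = (-1) ^ length (j # js) * (\<integral>x. (if set (j # js) \<subseteq> {i}
      then G (n + length (j # js)) (x $ i) else 0) * \<phi> x \<partial>lborel)"
    using Cons by (cases "j = i"; cases "set js \<subseteq> {i}") auto
  finally show ?case .
qed

text \<open>\<open>multi_deriv\<close> selects its list by choice, so nothing is known about it
  until some list with the prescribed counts is exhibited. One is read off from the multiset with
  multiplicities \<open>s\<close>.\<close>

lemma multi_index_list:
  fixes s :: "'d::finite \<Rightarrow> nat"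
  obtains "is" where "\<And>f. multi_deriv s f = iter_partial is f" "\<And>j. count_list is j = s j"
    "length is = (\<Sum>j\<in>UNIV. s j)"
proof -
  obtain xs :: "'d list" where xs: "mset xs = (\<Sum>j\<in>UNIV. replicate_mset (s j) j)"
    using ex_mset by blast
  have "count_list xs j = s j" for j
  proof -
    have "count_list xs j = count (\<Sum>j\<in>UNIV. replicate_mset (s j) j) j"
      unfolding xs[symmetric] count_mset ..
    also have "\<dots> = (\<Sum>i\<in>UNIV. if i = j then s i else 0)"
      unfolding count_sum by (rule sum.cong) auto
    finally show ?thesis by simp
  qed
  then have *: "\<forall>j. count_list (SOME is. \<forall>j. count_list is j = s j) j = s j"
    by (intro someI[of "\<lambda>is. \<forall>j. count_list is j = s j" xs]) blast
  define ys where "ys = (SOME is. \<forall>j. count_list is j = s j)"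
  have "sum (count_list ys) UNIV = length ys"
    by (rule sum_count_set) auto
  moreover have ys: "count_list ys = s"
    using * by (auto simp: ys_def)
  ultimately have "length ys = (\<Sum>j\<in>UNIV. s j)"
    by (simp only:)
  moreover have "multi_deriv s f = iter_partial ys f" for f
    unfolding multi_deriv_def ys_def ..
  ultimately show ?thesis
    using that[of ys] ys by blast
qed

lemma locally_integrable_continuous:
  fixes f :: "real ^ 'd \<Rightarrow> real"
  assumes "continuous_on UNIV f"
  shows "locally_integrable f"
  unfolding locally_integrable_def set_integrable_def
proof (intro allI impI)
  fix K :: "(real ^ 'd) set"
  assume K: "compact K"
  have i: "integrable lborel (\<lambda>x. indicator K x *\<^sub>R f x)"
    by (intro borel_integrable_compact K continuous_on_subset[OF assms]) auto
  then show "integrable lebesgue (\<lambda>x. indicator K x *\<^sub>R f x)"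
    by (subst integrable_completion) (auto dest: borel_measurable_integrable)
qed

text \<open>The classical derivative is a weak one. A multi-index that involves a coordinate other
  than \<open>i\<close> annihilates the function, whence the case distinction.\<close>

lemma has_weak_deriv_coordinate:
  fixes G :: "nat \<Rightarrow> real \<Rightarrow> real"
  assumes G: "\<And>m x. m < N \<Longrightarrow> (G m has_real_derivative G (Suc m) x) (at x)"
    "continuous_on UNIV (G N)" and s: "(\<Sum>j\<in>UNIV. s j) \<le> N"
  shows "has_weak_deriv (\<lambda>x. G 0 (x $ i)) s
    (\<lambda>x. if \<forall>j. j \<noteq> i \<longrightarrow> s j = 0 then G (\<Sum>j\<in>UNIV. s j) (x $ i) else 0)"
proof -
  let ?v = "\<lambda>x. if \<forall>j. j \<noteq> i \<longrightarrow> s j = 0 then G (\<Sum>j\<in>UNIV. s j) (x $ i) else 0"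
  have cont: "continuous_on UNIV (\<lambda>x. G m (x $ i))" if "m \<le> N" for m
  proof -
    have "continuous_on UNIV (G m)"
      using that G(1)[of m] G(2) DERIV_isCont
      by (cases "m = N") (auto intro!: continuous_at_imp_continuous_on)
    then show ?thesis
      by (rule continuous_on_compose2) (auto intro!: continuous_intros)
  qed
  have "continuous_on UNIV (\<lambda>x. if P then G (\<Sum>j\<in>UNIV. s j) (x $ i) else 0)" for P
    using cont[OF s] by (cases P) simp_all
  then have cont_v: "continuous_on UNIV ?v" .
  \<comment> \<open>The integrands are continuous with compact support, so the completed measure
    gives the same integral as \<open>lborel\<close>, where the integration by parts took
    place.\<close>
  have meas: "(LINT x|lebesgue. f x * \<phi> x) = (LINT x|lborel. f x * \<phi> x)"
    if "continuous_on UNIV f" "test_function \<phi>" for f \<phi> :: "real ^ 'd \<Rightarrow> real"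
    using integrable_mult_test[OF that] by (intro integral_completion) auto
  have "(LINT x|lebesgue. G 0 (x $ i) * multi_deriv s \<phi> x) =
      (-1) ^ (\<Sum>j\<in>UNIV. s j) * (LINT x|lebesgue. ?v x * \<phi> x)" if \<phi>: "test_function \<phi>" for \<phi>
  proof -
    obtain "is" where "is": "\<And>f. multi_deriv s f = iter_partial is f" "\<And>j. count_list is j = s j"
      "length is = (\<Sum>j\<in>UNIV. s j)"
      using multi_index_list by blast
    have "set is \<subseteq> {i} \<longleftrightarrow> (\<forall>j. j \<noteq> i \<longrightarrow> s j = 0)"
      by (auto simp flip: "is"(2) simp: count_list_0_iff)
    then show ?thesis
      using integral_iter_partial_coordinate[OF G \<phi>, of 0 "is" i, unfolded "is"(3) add_0] s
      by (simp add: meas cont[of 0] cont_v \<phi> "is" test_function_iter_partial)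
  qed
  then show ?thesis
    unfolding has_weak_deriv_def
    using locally_integrable_continuous[OF cont[of 0]] locally_integrable_continuous[OF cont_v]
    by auto
qed

subsection \<open>Products of functions of one coordinate\<close>

lemma has_partial_deriv_prod:
  fixes f :: "'d::finite \<Rightarrow> real \<Rightarrow> real"
  assumes "\<And>j. smooth_real (f j)"
  shows "has_partial_deriv i (\<lambda>x. \<Prod>j\<in>UNIV. f j (x $ j))
    (\<lambda>x. \<Prod>j\<in>UNIV. (if j = i then deriv (f j) else f j) (x $ j))"
  unfolding has_partial_deriv_def
proof
  fix x :: "real ^ 'd"
  let ?c = "\<Prod>j\<in>UNIV - {i}. f j (x $ j)"
  have eq: "(\<Prod>j\<in>UNIV. f j ((x + h *\<^sub>R axis i 1) $ j)) = f i (x $ i + h) * ?c" for h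
    by (subst prod.remove[of _ i]) (auto simp: axis_def intro!: prod.cong)
  have "((\<lambda>h. f i (x $ i + h)) has_real_derivative deriv (f i) (x $ i)) (at 0)"
    using smooth_real_derivative(1)[OF assms, of i "x $ i"]
      DERIV_shift[of "f i" "deriv (f i) (x $ i)" 0 "x $ i"] by (simp add: add.commute)
  then have "((\<lambda>h. f i (x $ i + h) * ?c) has_real_derivative deriv (f i) (x $ i) * ?c) (at 0)"
    by (rule DERIV_cmult_right)
  moreover have "(\<Prod>j\<in>UNIV. (if j = i then deriv (f j) else f j) (x $ j)) = deriv (f i) (x $ i) * ?c"
    by (subst prod.remove[of _ i]) (auto intro!: prod.cong)
  ultimately show "((\<lambda>h. \<Prod>j\<in>UNIV. f j ((x + h *\<^sub>R axis i 1) $ j)) has_real_derivative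
      (\<Prod>j\<in>UNIV. (if j = i then deriv (f j) else f j) (x $ j))) (at 0)"
    by (simp only: eq)
qed

text \<open>Products of one-variable functions are closed under partial differentiation, since each
  step differentiates a single factor. Smoothness in all variables thereby reduces to smoothness on
  the line.\<close>

lemma iter_partial_prod:
  fixes f :: "'d::finite \<Rightarrow> real \<Rightarrow> real"
  assumes "\<And>j. smooth_real (f j)"
  shows "iter_partial is (\<lambda>x. \<Prod>j\<in>UNIV. f j (x $ j)) =
    (\<lambda>x. \<Prod>j\<in>UNIV. (deriv ^^ count_list is j) (f j) (x $ j))"
proof (induction "is")
  case (Cons i "is")
  have "iter_partial (i # is) (\<lambda>x. \<Prod>j\<in>UNIV. f j (x $ j)) =
      partial_deriv i (\<lambda>x. \<Prod>j\<in>UNIV. (deriv ^^ count_list is j) (f j) (x $ j))"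
    by (simp add: Cons[symmetric] iter_partial_def)
  also have "\<dots> = (\<lambda>x. \<Prod>j\<in>UNIV. (if j = i then deriv ((deriv ^^ count_list is j) (f j))
      else (deriv ^^ count_list is j) (f j)) (x $ j))"
    by (intro has_partial_deriv_imp_eq has_partial_deriv_prod smooth_real_funpow_deriv assms)
  also have "\<dots> = (\<lambda>x. \<Prod>j\<in>UNIV. (deriv ^^ count_list (i # is) j) (f j) (x $ j))"
    by (intro ext prod.cong) auto
  finally show ?case .
qed (simp add: iter_partial_def)

lemma test_function_prod:
  fixes f :: "'d::finite \<Rightarrow> real \<Rightarrow> real"
  assumes f: "\<And>j. smooth_real (f j)" and supp: "\<And>j y. f j y \<noteq> 0 \<Longrightarrow> l j \<le> y \<and> y \<le> u j"
  shows "test_function (\<lambda>x. \<Prod>j\<in>UNIV. f j (x $ j))"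
proof -
  have diff: "(\<lambda>x. \<Prod>j\<in>UNIV. g j (x $ j)) differentiable (at x)"
    if "\<And>j. smooth_real (g j)" for g :: "'d \<Rightarrow> real \<Rightarrow> real" and x :: "real ^ 'd"
  proof -
    have "((\<lambda>x. g j (x $ j)) has_derivative (\<lambda>h. h $ j * deriv (g j) (x $ j))) (at x)" for j
      by (rule DERIV_compose_FDERIV[where f = "g j"])
        (use that smooth_real_derivative in \<open>auto intro!: bounded_linear_imp_has_derivative bounded_linear_vec_nth\<close>)
    then have "((\<lambda>x. \<Prod>j\<in>UNIV. g j (x $ j)) has_derivative (\<lambda>y. \<Sum>i\<in>UNIV.
        (y $ i * deriv (g i) (x $ i)) * (\<Prod>j\<in>UNIV - {i}. g j (x $ j)))) (at x)"
      by (rule has_derivative_prod)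
    then show ?thesis
      by (auto simp: differentiable_def)
  qed
  have "smooth (\<lambda>x. \<Prod>j\<in>UNIV. f j (x $ j))"
    unfolding smooth_def iter_partial_prod[of f, OF f]
    by (intro allI diff smooth_real_funpow_deriv f)
  moreover have "closure {x. (\<Prod>j\<in>UNIV. f j (x $ j)) \<noteq> 0} \<subseteq> cbox (\<chi> j. l j) (\<chi> j. u j)"
    using supp by (intro closure_minimal closed_cbox) (auto simp: mem_box_cart)
  then have "compact (closure {x. (\<Prod>j\<in>UNIV. f j (x $ j)) \<noteq> 0})"
    using compact_Int_closed[OF compact_cbox closed_closure, of "\<chi> j. l j" "\<chi> j. u j"]
    by (metis Int_absorb1)
  ultimately show ?thesis
    by (simp add: test_function_def)
qed

section \<open>Integrals of products over the coordinates\<close>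

lemma nn_integral_prod_coordinates:
  fixes f :: "'d::finite \<Rightarrow> real \<Rightarrow> ennreal"
  assumes "\<And>j. f j \<in> borel_measurable borel"
  shows "(\<integral>\<^sup>+x. (\<Prod>j\<in>UNIV. f j (x $ j)) \<partial>lborel) = (\<Prod>j\<in>UNIV. \<integral>\<^sup>+y. f j y \<partial>lborel)"
proof -
  have inj: "inj (\<lambda>j::'d. axis j (1::real))"
    by (auto simp: inj_on_def axis_eq_axis)
  have basis: "(Basis :: (real ^ 'd) set) = range (\<lambda>j. axis j 1)"
    by (auto simp: Basis_vec_def)
  have "(\<integral>\<^sup>+x. (\<Prod>b\<in>Basis. f (axis_index b) ((x :: real ^ 'd) \<bullet> b)) \<partial>lborel) =
      (\<Prod>b\<in>(Basis :: (real ^ 'd) set). \<integral>\<^sup>+y. f (axis_index b) y \<partial>lborel)"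
    by (rule nn_integral_lborel_prod[where f = "\<lambda>b. f (axis_index b)"]) (use assms in auto)
  then show ?thesis
    unfolding basis prod.reindex[OF inj] by (simp add: inner_axis axis_index_axis)
qed

lemma measurable_coordinate:
  "h \<in> borel_measurable borel \<Longrightarrow> (\<lambda>x::real^'d. h (x $ i) :: real) \<in> borel_measurable borel"
  by (rule measurable_compose[of "\<lambda>x. x $ i" _ borel])
     (auto intro!: borel_measurable_continuous_onI continuous_intros)

lemma integral_prod_coordinates:
  fixes f :: "'d::finite \<Rightarrow> real \<Rightarrow> real"
  assumes "\<And>j. integrable lborel (f j)" "\<And>j y. f j y \<ge> 0"
  shows "(\<integral>x. (\<Prod>j\<in>UNIV. f j (x $ j)) \<partial>lborel) = (\<Prod>j\<in>UNIV. \<integral>y. f j y \<partial>lborel)"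
proof -
  have [measurable]: "f j \<in> borel_measurable borel" for j
    using borel_measurable_integrable[OF assms(1)[of j]] by simp
  have "(\<integral>\<^sup>+x. ennreal (\<Prod>j\<in>UNIV. f j (x $ j)) \<partial>lborel) =
      (\<integral>\<^sup>+x. (\<Prod>j\<in>UNIV. ennreal (f j (x $ j))) \<partial>lborel)"
    using assms(2) by (simp add: prod_ennreal)
  also have "\<dots> = (\<Prod>j\<in>UNIV. \<integral>\<^sup>+y. ennreal (f j y) \<partial>lborel)"
    by (rule nn_integral_prod_coordinates) measurable
  also have "\<dots> = ennreal (\<Prod>j\<in>UNIV. \<integral>y. f j y \<partial>lborel)"
    using assms by (simp add: nn_integral_eq_integral prod_ennreal)
  finally have *: "(\<integral>\<^sup>+x. ennreal (\<Prod>j\<in>UNIV. f j (x $ j)) \<partial>lborel) =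
      ennreal (\<Prod>j\<in>UNIV. \<integral>y. f j y \<partial>lborel)" .
  have m: "(\<lambda>x. \<Prod>j\<in>UNIV. f j (x $ j)) \<in> borel_measurable lborel"
    using measurable_coordinate[of "f _"] by measurable
  show ?thesis
    using assms(2)
    by (subst integral_eq_nn_integral[OF m])
      (simp_all add: * prod_nonneg Bochner_Integration.integral_nonneg)
qed

subsection \<open>The deformed exponential\<close>

lemma log_d_derivative: "x > 0 \<Longrightarrow> (log_d has_real_derivative 1 + 1 / x) (at x)"
  unfolding log_d_def[abs_def] by (auto intro!: derivative_eq_intros)

lemma log_d_strict_mono: "0 < x \<Longrightarrow> x < y \<Longrightarrow> log_d x < log_d y"
  by (simp add: log_d_def add_strict_mono)

lemma log_d_surj: "y \<in> log_d ` {0<..}"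
proof -
  \<comment> \<open>The endpoints enclose y: at exp(-|y|) the linear part is at most 0 and the
    logarithm equals -|y|; at 1 + |y| the linear part equals |y| and the logarithm is
    nonnegative.\<close>
  have cont: "continuous_on {exp (- \<bar>y\<bar>)..1 + \<bar>y\<bar>} log_d"
  proof (intro continuous_at_imp_continuous_on ballI)
    fix x assume "x \<in> {exp (- \<bar>y\<bar>)..1 + \<bar>y\<bar>}"
    then have "x > 0" using less_le_trans[OF exp_gt_zero] by auto
    then show "isCont log_d x" using log_d_derivative DERIV_isCont by blast
  qed
  have le1: "exp (- \<bar>y\<bar>) \<le> 1"
    by simp
  have "log_d (exp (- \<bar>y\<bar>)) \<le> y"
    using le1 abs_ge_minus_self[of y] unfolding log_d_def ln_exp by linarith
  moreover have "y \<le> log_d (1 + \<bar>y\<bar>)"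
    using ln_ge_zero[of "1 + \<bar>y\<bar>"] abs_ge_self[of y] unfolding log_d_def by linarith
  moreover have "exp (- \<bar>y\<bar>) \<le> 1 + \<bar>y\<bar>"
    using le1 by linarith
  ultimately obtain x where "exp (- \<bar>y\<bar>) \<le> x" "log_d x = y"
    using IVT'[of log_d "exp (- \<bar>y\<bar>)" y "1 + \<bar>y\<bar>"] cont by blast
  then show ?thesis
    using less_le_trans[OF exp_gt_zero] by (metis greaterThan_iff image_eqI)
qed

lemma psi_pos: "psi y > 0" and log_d_psi: "log_d (psi y) = y"
  using inv_into_into[OF log_d_surj] f_inv_into_f[OF log_d_surj] by (auto simp: psi_def)

lemma psi_log_d: "x > 0 \<Longrightarrow> psi (log_d x) = x"
  by (metis log_d_psi log_d_strict_mono less_irrefl linorder_cases psi_pos)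

lemma isCont_psi: "isCont psi y"
proof -
  have pos: "z > 0" if "\<bar>z - psi y\<bar> \<le> psi y / 2" for z
    using that psi_pos[of y] by (auto simp: abs_if split: if_splits)
  have "isCont psi (log_d (psi y))"
    by (rule isCont_inverse_function[where d = "psi y / 2"])
       (use psi_pos psi_log_d pos DERIV_isCont[OF log_d_derivative] in auto)
  then show ?thesis by (simp add: log_d_psi)
qed

lemma psi_derivative: "(psi has_real_derivative psi y / (1 + psi y)) (at y)"
proof -
  have "(psi has_real_derivative inverse (1 + 1 / psi y)) (at y)"
    by (rule DERIV_inverse_function[where f = log_d and a = "y - 1" and b = "y + 1"])
       (use log_d_derivative[OF psi_pos] psi_pos[of y] isCont_psi log_d_psi in \<open>auto simp: add_pos_pos less_imp_neq[symmetric]\<close>)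
  moreover have "inverse (1 + 1 / psi y) = psi y / (1 + psi y)"
    using psi_pos[of y] by (simp add: field_simps)
  ultimately show ?thesis by simp
qed

text \<open>The form matters: this second derivative of \<open>psi\<close> is visibly positive and
  continuous, hence bounded below by a positive constant on compact intervals.\<close>

lemma psi_derivative2:
  "((\<lambda>y. psi y / (1 + psi y)) has_real_derivative psi y / (1 + psi y) ^ 3) (at y)"
proof -
  define q where "q = 1 + psi y"
  have q: "q \<noteq> 0" "q - psi y = 1"
    using psi_pos[of y] by (auto simp: q_def)
  have "((\<lambda>y. psi y / (1 + psi y)) has_real_derivative
      (psi y / q * (1 + psi y) - psi y * (psi y / q)) / ((1 + psi y) * (1 + psi y))) (at y)"
    unfolding q_def using q by (intro DERIV_divide psi_derivative)
      (auto intro!: derivative_eq_intros psi_derivative simp: q_def)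
  also have "(psi y / q * (1 + psi y) - psi y * (psi y / q)) = psi y / q * (q - psi y)"
    by (simp add: q_def algebra_simps add_divide_distrib)
  also have "psi y / q * (q - psi y) / ((1 + psi y) * (1 + psi y)) = psi y / q ^ 3"
    using q by (simp add: q_def power3_eq_cube)
  finally show ?thesis
    by (simp add: q_def)
qed

lemma continuous_on_psi2: "continuous_on S (\<lambda>y. psi y / (1 + psi y) ^ 3)"
proof -
  have "continuous_on S psi"
    using isCont_psi by (simp add: continuous_at_imp_continuous_on)
  moreover have "1 + psi y \<noteq> 0" for y
    using psi_pos[of y] by linarith
  ultimately show ?thesis
    by (auto intro!: continuous_intros)
qed

subsection \<open>Spike trains\<close>

text \<open>The cell starting at n contributes at most B^p * A(n)^p * w(n), because the weight
  decreases on the half-line and is largest at the left end. Negative arguments contribute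
  nothing.\<close>

lemma nn_integral_spike_train_finite:
  assumes p: "p > 0" and w: "\<And>x y. 0 \<le> x \<Longrightarrow> x \<le> y \<Longrightarrow> w y \<le> w x" "\<And>x. w x \<ge> 0"
    and A: "\<And>n. A n \<ge> 0" "summable (\<lambda>n. A n powr p * w (real n))"
    and f: "\<And>x. \<bar>f x\<bar> \<le> B" "\<And>x. x \<le> 0 \<or> 1 \<le> x \<Longrightarrow> f x = 0"
  shows "(\<integral>\<^sup>+z. ennreal (\<bar>spike_train A f z\<bar> powr p * w \<bar>z\<bar>) \<partial>lborel) < \<infinity>"
proof -
  let ?c = "\<lambda>n. B powr p * (A n powr p * w (real n))"
  have c: "?c n \<ge> 0" for n
    using w A by simp
  have "ennreal (\<bar>spike_train A f z\<bar> powr p * w \<bar>z\<bar>)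
      \<le> (\<Sum>n. ennreal (?c n) * indicator {real n..real n + 1} z)" for z
  proof (cases "z \<le> 0")
    case True
    then show ?thesis using f(2)[of z] by (simp add: spike_train_def)
  next
    case False
    define n where "n = nat \<lfloor>z\<rfloor>"
    define F :: "nat \<Rightarrow> ennreal"
      where "F n = ennreal (?c n) * indicator {real n..real n + 1} z" for n
    have n: "real n \<le> z" "z \<le> real n + 1"
      using False unfolding n_def by linarith+
    have "\<bar>spike_train A f z\<bar> powr p = A n powr p * \<bar>f (z - real n)\<bar> powr p"
      using A by (simp add: spike_train_def n_def abs_mult powr_mult)
    also have "\<dots> \<le> A n powr p * B powr p"
      using f p by (intro mult_left_mono powr_mono2) auto
    finally have "\<bar>spike_train A f z\<bar> powr p * w \<bar>z\<bar> \<le> (A n powr p * B powr p) * w (real n)"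
      using w n False by (intro mult_mono) auto
    then have "ennreal (\<bar>spike_train A f z\<bar> powr p * w \<bar>z\<bar>)
        \<le> F n"
      using n by (auto intro!: ennreal_leI simp: mult_ac F_def)
    also have "\<dots> = sum F {n}"
      by simp
    also have "\<dots> \<le> suminf F"
      by (rule sum_le_suminf) auto
    also have "\<dots> = (\<Sum>n. ennreal (?c n) * indicator {real n..real n + 1} z)"
      unfolding F_def ..
    finally show ?thesis .
  qed
  then have "(\<integral>\<^sup>+z. ennreal (\<bar>spike_train A f z\<bar> powr p * w \<bar>z\<bar>) \<partial>lborel)
      \<le> (\<integral>\<^sup>+z. (\<Sum>n. ennreal (?c n) * indicator {real n..real n + 1} z) \<partial>lborel)"
    by (intro nn_integral_mono) auto
  also have "\<dots> = (\<Sum>n. \<integral>\<^sup>+z. ennreal (?c n) * indicator {real n..real n + 1} z \<partial>lborel)"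
    by (rule nn_integral_suminf) auto
  also have "\<dots> = (\<Sum>n. ennreal (?c n))"
    by (simp add: nn_integral_cmult_indicator)
  also have "\<dots> = ennreal (\<Sum>n. ?c n)"
    using c A by (intro suminf_ennreal2 summable_mult) auto
  finally show ?thesis
    by (rule le_less_trans) simp
qed

section \<open>Integrability with respect to the reference measure\<close>

lemma exp_log_density: "exp (log_density \<theta> C x) = (\<Prod>j\<in>UNIV. exp (C - \<theta> \<bar>x $ j\<bar>))"
  by (simp add: log_density_def exp_sum)

lemma measurable_exp_log_density:
  fixes \<theta> :: "real \<Rightarrow> real"
  assumes [measurable]: "(\<lambda>z. \<theta> \<bar>z\<bar>) \<in> borel_measurable borel"
  shows "(\<lambda>x::real^'d. exp (log_density \<theta> C x)) \<in> borel_measurable borel"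
proof -
  have [measurable]: "(\<lambda>x::real^'d. x $ j) \<in> borel_measurable borel" for j
    by (intro borel_measurable_continuous_onI continuous_intros)
  show ?thesis
    unfolding log_density_def by measurable
qed

lemma integrable_reference_measure_iff:
  fixes \<theta> :: "real \<Rightarrow> real" and f :: "real ^ 'd \<Rightarrow> real"
  assumes "(\<lambda>z. \<theta> \<bar>z\<bar>) \<in> borel_measurable borel" "f \<in> borel_measurable lebesgue"
  shows "integrable (reference_measure \<theta> C) f \<longleftrightarrow>
     integrable lebesgue (\<lambda>x. exp (log_density \<theta> C x) * f x)"
  unfolding reference_measure_def
  using measurable_completion[of _ lborel borel, simplified] measurable_exp_log_density[OF assms(1), of C, where 'd='d] assms(2)
  by (subst integrable_density) (auto intro: measurable_completion)

text \<open>By Tonelli the integral factors over the coordinates. The factor at \<open>i\<close> is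
  the weighted one-dimensional integral of \<open>h\<close>; every other factor is the total mass of
  the one-dimensional weight.\<close>

lemma coordinate_in_Lp:
  fixes \<theta> h :: "real \<Rightarrow> real" and i :: "'d::finite"
  assumes \<theta>: "(\<lambda>z. \<theta> \<bar>z\<bar>) \<in> borel_measurable borel"
    and h: "h \<in> borel_measurable borel"
    and fin: "(\<integral>\<^sup>+z. ennreal (exp (C - \<theta> \<bar>z\<bar>)) \<partial>lborel) < \<infinity>"
      "(\<integral>\<^sup>+z. ennreal (\<bar>h z\<bar> powr p * exp (C - \<theta> \<bar>z\<bar>)) \<partial>lborel) < \<infinity>"
  shows "(\<lambda>x. h (x $ i)) \<in> Lp_fun p (reference_measure \<theta> C :: (real ^ 'd) measure)"
proof -
  note [measurable] = \<theta> h measurable_coordinate measurable_exp_log_density[OF \<theta>]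
  have hm: "(\<lambda>x::real^'d. h (x $ i)) \<in> borel_measurable lebesgue"
    by (rule measurable_completion) measurable
  have "(\<integral>\<^sup>+x. ennreal (exp (log_density \<theta> C x) * \<bar>h (x $ i)\<bar> powr p) \<partial>(lborel :: (real^'d) measure)) =
    (\<integral>\<^sup>+x. (\<Prod>j\<in>UNIV. ennreal ((if j = i then \<bar>h (x $ j)\<bar> powr p else 1) * exp (C - \<theta> \<bar>x $ j\<bar>)))
      \<partial>(lborel :: (real^'d) measure))"
    by (intro nn_integral_cong)
      (simp add: prod_ennreal exp_log_density prod.distrib mult.commute)
  also have "\<dots> = (\<Prod>j\<in>UNIV. \<integral>\<^sup>+y. ennreal ((if j = i then \<bar>h y\<bar> powr p else 1) *
      exp (C - \<theta> \<bar>y\<bar>)) \<partial>lborel)"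
    by (rule nn_integral_prod_coordinates[of "\<lambda>j y. ennreal ((if j = i then \<bar>h y\<bar> powr p else 1) *
      exp (C - \<theta> \<bar>y\<bar>))"]) measurable
  also have "\<dots> < \<infinity>"
  proof -
    have "(\<integral>\<^sup>+y. ennreal ((if j = i then \<bar>h y\<bar> powr p else 1) * exp (C - \<theta> \<bar>y\<bar>)) \<partial>lborel) \<noteq> top" for j
      using fin by (cases "j = i") auto
    then show ?thesis
      by (simp add: ennreal_prod_eq_top less_top[symmetric])
  qed
  finally have "integrable lborel (\<lambda>x::real^'d. exp (log_density \<theta> C x) * \<bar>h (x $ i)\<bar> powr p)"
    by (intro integrableI_nonneg) auto
  then have "integrable lebesgue (\<lambda>x::real^'d. exp (log_density \<theta> C x) * \<bar>h (x $ i)\<bar> powr p)"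
    by (subst integrable_completion) auto
  then have "integrable (reference_measure \<theta> C) (\<lambda>x::real^'d. \<bar>h (x $ i)\<bar> powr p)"
    using hm by (subst integrable_reference_measure_iff[OF \<theta>]) auto
  then show ?thesis
    using hm by (simp add: Lp_fun_def reference_measure_def)
qed

section \<open>The spike and its composition with psi\<close>

definition spike :: "real \<Rightarrow> real" where
  "spike x = (x - 1 / 2) * bump x"

lemma smooth_real_spike: "smooth_real spike"
proof -
  have "smooth_real (\<lambda>x. (1 * x + (- 1 / 2)) * bump x)"
    by (intro smooth_real_mult smooth_real_affine[OF smooth_real_ident] smooth_real_bump)
  then show ?thesis
    by (simp add: spike_def[abs_def])
qed

lemma spike_eq_0: "x \<le> 0 \<or> 1 \<le> x \<Longrightarrow> spike x = 0"
  by (simp add: spike_def bump_eq_0)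

lemma bump_nonzeroD: "bump z \<noteq> 0 \<Longrightarrow> 0 < z \<and> z < 1"
  using bump_eq_0[of z] by linarith

lemma deriv_spike_half: "deriv spike (1 / 2) > 0"
proof -
  have "(spike has_real_derivative 1 * bump (1 / 2) + deriv bump (1 / 2) * (1 / 2 - 1 / 2)) (at (1 / 2))"
    unfolding spike_def[abs_def]
    by (intro DERIV_mult smooth_real_derivative smooth_real_bump) (auto intro!: derivative_eq_intros)
  then show ?thesis
    using bump_pos[of "1 / 2"] by (simp add: DERIV_imp_deriv)
qed

abbreviation spikes :: "(nat \<Rightarrow> real) \<Rightarrow> nat \<Rightarrow> real \<Rightarrow> real" where
  "spikes A k \<equiv> spike_train A ((deriv ^^ k) spike)"

lemma spikes_derivative: "(spikes A k has_real_derivative spikes A (Suc k) x) (at x)"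
proof (rule spike_train_derivative)
  show "((deriv ^^ k) spike has_real_derivative (deriv ^^ Suc k) spike x) (at x)" for x
    using smooth_real_derivative(1)[OF smooth_real_funpow_deriv[OF smooth_real_spike]] by simp
qed (rule funpow_deriv_vanish_outside[OF smooth_real_spike spike_eq_0]; assumption)+

lemma continuous_on_spikes: "continuous_on S (spikes A k)"
  by (intro continuous_at_imp_continuous_on ballI DERIV_isCont[OF spikes_derivative])

text \<open>Meaningful for \<open>k \<le> 2\<close> only: the composition and its first two derivatives.\<close>

primrec psi_spikes :: "(nat \<Rightarrow> real) \<Rightarrow> nat \<Rightarrow> real \<Rightarrow> real" where
  "psi_spikes A 0 = (\<lambda>y. psi (spikes A 0 y))"
| "psi_spikes A (Suc k) = (if k = 0
     then (\<lambda>y. psi (spikes A 0 y) / (1 + psi (spikes A 0 y)) * spikes A 1 y)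
     else (\<lambda>y. psi (spikes A 0 y) / (1 + psi (spikes A 0 y)) ^ 3 * (spikes A 1 y)\<^sup>2 +
        psi (spikes A 0 y) / (1 + psi (spikes A 0 y)) * spikes A 2 y))"

lemma psi_spikes_2: "psi_spikes A 2 y =
    psi (spikes A 0 y) / (1 + psi (spikes A 0 y)) ^ 3 * (spikes A 1 y)\<^sup>2 +
    psi (spikes A 0 y) / (1 + psi (spikes A 0 y)) * spikes A 2 y"
  by (simp add: numeral_2_eq_2)

lemma psi_spikes_derivative:
  assumes "m < 2"
  shows "(psi_spikes A m has_real_derivative psi_spikes A (Suc m) x) (at x)"
proof (cases "m = 0")
  case True
  have "((\<lambda>y. psi (spikes A 0 y)) has_real_derivative
      psi (spikes A 0 x) / (1 + psi (spikes A 0 x)) * spikes A (Suc 0) x) (at x)"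
    by (rule DERIV_chain2[OF psi_derivative spikes_derivative])
  then show ?thesis
    using True by simp
next
  case False
  then have "m = 1" using assms by simp
  have "((\<lambda>y. psi (spikes A 0 y) / (1 + psi (spikes A 0 y))) has_real_derivative
      psi (spikes A 0 x) / (1 + psi (spikes A 0 x)) ^ 3 * spikes A (Suc 0) x) (at x)"
    by (rule DERIV_chain2[OF psi_derivative2 spikes_derivative])
  from DERIV_mult[OF this spikes_derivative[of A 1 x]] show ?thesis
    using \<open>m = 1\<close> by (simp add: power2_eq_square mult_ac add.commute numeral_2_eq_2)
qed

lemma continuous_on_psi_spikes_2: "continuous_on S (psi_spikes A 2)"
proof -
  have "continuous_on S (\<lambda>y. psi (spikes A 0 y) / (1 + psi (spikes A 0 y)) ^ 3)"
    by (rule continuous_on_compose2[OF continuous_on_psi2[of UNIV] continuous_on_spikes]) auto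
  moreover have "continuous_on S (\<lambda>y. psi (spikes A 0 y) / (1 + psi (spikes A 0 y)))"
    by (rule continuous_on_compose2[of UNIV "\<lambda>y. psi y / (1 + psi y)", OF _ continuous_on_spikes])
      (auto intro!: continuous_at_imp_continuous_on DERIV_isCont[OF psi_derivative2])
  ultimately show ?thesis
    unfolding psi_spikes_2[abs_def]
    by (intro continuous_on_add continuous_on_mult continuous_on_power continuous_on_spikes)
qed

text \<open>Each spike crosses zero with slope of order \<open>A n\<close>, so it stays of order one, where
  \<open>\<psi>''\<close> is bounded below, on a window of width of order \<open>1 / A n\<close>.\<close>

lemma psi_spikes_2_lower_bound:
  obtains \<delta> \<kappa> L :: real where "0 < \<delta>" "\<delta> \<le> 1 / 4" "0 < \<kappa>" "1 \<le> L"
    "\<And>A n y. L \<le> A n \<Longrightarrow> real n + 1 / 2 \<le> y \<Longrightarrow> y \<le> real n + 1 / 2 + \<delta> / A n \<Longrightarrow>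
       \<kappa> * (A n)\<^sup>2 \<le> psi_spikes A 2 y"
proof -
  \<comment> \<open>Half the slope at the crossing: by continuity the slope stays above this value
    near 1/2.\<close>
  define \<beta> where "\<beta> = deriv spike (1 / 2) / 2"
  have \<beta>: "\<beta> > 0" using deriv_spike_half by (simp add: \<beta>_def)
  have "isCont (deriv spike) (1 / 2)"
    using smooth_real_derivative[OF smooth_real_spike] DERIV_isCont smooth_real_derivative(1) by blast
  then obtain d where d: "d > 0" "\<And>y. \<bar>y - 1 / 2\<bar> < d \<Longrightarrow> \<bar>deriv spike y - deriv spike (1 / 2)\<bar> < \<beta>"
    unfolding continuous_at_eps_delta dist_real_def using \<beta> by meson
  \<comment> \<open>The bound 1/4 keeps the window inside the cell of the n-th spike, and d / 2
    keeps it where the slope is controlled.\<close>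
  define \<delta> where "\<delta> = min (1 / 4) (d / 2)"
  have \<delta>: "0 < \<delta>" "\<delta> \<le> 1 / 4" "\<delta> < d" using d(1) by (auto simp: \<delta>_def)
  obtain B where B: "\<And>x. \<bar>(deriv ^^ 2) spike x\<bar> \<le> B"
    using smooth_unit_support_bounded[OF smooth_real_funpow_deriv[OF smooth_real_spike]
        funpow_deriv_vanish_outside[OF smooth_real_spike spike_eq_0]] by blast
  \<comment> \<open>On the window the spike takes values in the unit interval, so the minimum of
    \<open>psi''\<close> there is the relevant lower bound.\<close>
  have "\<exists>s\<in>{0..1}. \<forall>y\<in>{0..1}. psi s / (1 + psi s) ^ 3 \<le> psi y / (1 + psi y) ^ 3"
    by (intro continuous_attains_inf continuous_on_psi2) auto
  then obtain s where s: "\<And>y. y \<in> {0..1} \<Longrightarrow> psi s / (1 + psi s) ^ 3 \<le> psi y / (1 + psi y) ^ 3"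
    by blast
  define \<gamma> where "\<gamma> = psi s / (1 + psi s) ^ 3"
  have \<gamma>: "\<gamma> > 0" using psi_pos[of s] by (simp add: \<gamma>_def)
  \<comment> \<open>For A(n) above this threshold the term psi'(a) * a'', at least -A(n) * B, uses
    up at most half of the quadratic term \<gamma> * (A(n) * \<beta>)^2.\<close>
  define L where "L = max 1 (2 * B / (\<gamma> * \<beta>\<^sup>2))"
  have "\<gamma> * \<beta>\<^sup>2 / 2 * (A n)\<^sup>2 \<le> psi_spikes A 2 y"
    if L: "L \<le> A n" and y: "real n + 1 / 2 \<le> y" "y \<le> real n + 1 / 2 + \<delta> / A n" for A n y
  proof -
    have An: "A n \<ge> 1" "2 * B / (\<gamma> * \<beta>\<^sup>2) \<le> A n" using L by (auto simp: L_def)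
    define u where "u = y - real n - 1 / 2"
    have "\<delta> / A n \<le> \<delta>" using An \<delta> by (simp add: divide_le_eq)
    then have u: "0 \<le> u" "u \<le> \<delta>" "u \<le> \<delta> / A n" using y by (auto simp: u_def)
    have "nat \<lfloor>y\<rfloor> = n"
      using u(1,2) \<delta>(2) by (simp add: u_def) linarith
    then have eq: "spikes A k y = A n * (deriv ^^ k) spike (1 / 2 + u)" for k
      by (simp add: spike_train_def u_def)
    have "spikes A 0 y = A n * u * bump (1 / 2 + u)"
      using eq[of 0] by (simp add: spike_def)
    moreover have "A n * u \<le> 1"
      using u(3) An \<delta> by (simp add: field_simps)
    then have "A n * u * bump (1 / 2 + u) \<le> 1"
      by (rule mult_le_one[OF _ bump_nonneg bump_le_1])
    moreover have "0 \<le> A n * u * bump (1 / 2 + u)"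
      using bump_nonneg u An by simp
    ultimately have g0: "\<gamma> \<le> psi (spikes A 0 y) / (1 + psi (spikes A 0 y)) ^ 3"
      unfolding \<gamma>_def by (intro s) simp
    have "\<bar>deriv spike (1 / 2 + u) - deriv spike (1 / 2)\<bar> < \<beta>"
      using u \<delta> by (intro d(2)) simp
    then have "\<beta> \<le> deriv spike (1 / 2 + u)"
      unfolding \<beta>_def abs_less_iff by linarith
    then have "(A n * \<beta>)\<^sup>2 \<le> (spikes A 1 y)\<^sup>2"
      using An \<beta> eq[of 1] by (intro power_mono) auto
    then have first: "\<gamma> * (A n * \<beta>)\<^sup>2 \<le>
        psi (spikes A 0 y) / (1 + psi (spikes A 0 y)) ^ 3 * (spikes A 1 y)\<^sup>2"
      using g0 \<gamma> by (intro mult_mono) auto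
    have "\<bar>psi (spikes A 0 y) / (1 + psi (spikes A 0 y))\<bar> \<le> 1"
      using psi_pos[of "spikes A 0 y"] by simp
    then have "\<bar>psi (spikes A 0 y) / (1 + psi (spikes A 0 y))\<bar> * \<bar>spikes A 2 y\<bar> \<le> 1 * (A n * B)"
      using B[of "1 / 2 + u"] An by (intro mult_mono) (auto simp: eq[of 2] abs_mult)
    then have second: "- (A n * B) \<le>
        psi (spikes A 0 y) / (1 + psi (spikes A 0 y)) * spikes A 2 y"
      by (metis abs_le_iff abs_mult minus_le_iff mult_1)
    have "A n * B \<le> A n * (\<gamma> * \<beta>\<^sup>2 / 2 * A n)"
      using An \<gamma> \<beta> by (intro mult_left_mono) (auto simp: divide_le_eq mult_ac)
    then have "\<gamma> * \<beta>\<^sup>2 / 2 * (A n)\<^sup>2 \<le> \<gamma> * (A n * \<beta>)\<^sup>2 - A n * B"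
      by (simp add: power2_eq_square algebra_simps)
    then show ?thesis
      unfolding psi_spikes_2 using first second by linarith
  qed
  moreover have "1 \<le> L" "\<gamma> * \<beta>\<^sup>2 / 2 > 0" using \<gamma> \<beta> by (auto simp: L_def)
  ultimately show ?thesis
    using that[of \<delta> "\<gamma> * \<beta>\<^sup>2 / 2" L] \<delta> by blast
qed

text \<open>Testing against one function \<open>\<phi>\<close> stands in for Hoelder's inequality: split according to
  whether \<open>\<bar>v\<bar> \<le> M\<close>.\<close>

lemma weighted_Chebyshev:
  fixes v \<phi> r M p \<rho> :: real
  assumes "0 \<le> \<phi>" "\<phi> \<le> 1" "0 < M" "1 < p" "0 < \<rho>" "0 \<le> r" "\<phi> \<noteq> 0 \<Longrightarrow> \<rho> \<le> r"
  shows "v * \<phi> \<le> M * \<phi> + M powr (1 - p) / \<rho> * (r * \<bar>v\<bar> powr p)"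
proof (cases "\<phi> = 0")
  case True
  then show ?thesis using assms by simp
next
  case False
  show ?thesis
  proof (cases "\<bar>v\<bar> \<le> M")
    case True
    then have "v * \<phi> \<le> M * \<phi>"
      using assms by (intro mult_right_mono) auto
    moreover have "0 \<le> M powr (1 - p) / \<rho> * (r * \<bar>v\<bar> powr p)"
      using assms by simp
    ultimately show ?thesis by linarith
  next
    case False
    have "v * \<phi> \<le> \<bar>v\<bar> * 1"
      using assms by (intro mult_mono) auto
    also have "\<dots> = \<bar>v\<bar> powr (1 - p) * \<bar>v\<bar> powr p"
      using False assms by (simp flip: powr_add)
    also have "\<dots> \<le> M powr (1 - p) * \<bar>v\<bar> powr p"
      using False assms by (intro mult_right_mono powr_mono2') auto
    also have "\<dots> \<le> M powr (1 - p) * \<bar>v\<bar> powr p * (r / \<rho>)"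
      using assms \<open>\<phi> \<noteq> 0\<close> by (simp add: le_divide_eq mult_left_mono)
    also have "\<dots> \<le> M * \<phi> + M powr (1 - p) / \<rho> * (r * \<bar>v\<bar> powr p)"
      using assms by (simp add: mult_ac)
    finally show ?thesis .
  qed
qed

text \<open>Each sufficiently high spike forces c * A(n)^(2p - 1) * w(n + 1) \<le> V, where V is the
  p-th power of the norm of the supposed weak derivative and neither c nor V depends on n. The
  second limit in the assumptions contradicts this; the first makes the spikes high enough for the
  pointwise lower bound.\<close>

lemma psi_spikes_not_sobolev:
  fixes \<theta> :: "real \<Rightarrow> real" and i :: "'d::finite"
  assumes \<theta>: "mono_on {0..} \<theta>" "(\<lambda>z. \<theta> \<bar>z\<bar>) \<in> borel_measurable borel" and p: "1 < p" and k: "2 \<le> k"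
    and A: "filterlim A at_top sequentially"
      "filterlim (\<lambda>n. A n powr (2 * p - 1) * exp (C - \<theta> (real (Suc n)))) at_top sequentially"
  shows "(\<lambda>x. psi (spike_train A spike (x $ i)))
    \<notin> sobolev k p (reference_measure \<theta> C :: (real ^ 'd) measure)"
proof
  assume "(\<lambda>x. psi (spike_train A spike (x $ i)))
    \<in> sobolev k p (reference_measure \<theta> C :: (real ^ 'd) measure)"
  moreover define s where "s = (\<lambda>j. if j = i then 2 else 0 :: nat)"
  have sum_s: "(\<Sum>j\<in>UNIV. s j) = 2"
    by (simp add: s_def)
  then have "1 \<le> (\<Sum>j\<in>UNIV. s j) \<and> (\<Sum>j\<in>UNIV. s j) \<le> k"
    using k by simp
  ultimately obtain v where v: "v \<in> Lp_fun p (reference_measure \<theta> C :: (real ^ 'd) measure)"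
    and v_deriv: "has_weak_deriv (\<lambda>x. psi (spike_train A spike (x $ i))) s v"
    unfolding sobolev_def by blast
  have "has_weak_deriv (\<lambda>x. psi_spikes A 0 (x $ i)) s
    (\<lambda>x. if \<forall>j. j \<noteq> i \<longrightarrow> s j = 0 then psi_spikes A (\<Sum>j\<in>UNIV. s j) (x $ i) else 0)"
    by (rule has_weak_deriv_coordinate[where N = 2])
      (use psi_spikes_derivative continuous_on_psi_spikes_2 sum_s in auto)
  moreover have "\<forall>j. j \<noteq> i \<longrightarrow> s j = 0"
    by (simp add: s_def)
  ultimately have classical: "has_weak_deriv (\<lambda>x. psi (spike_train A spike (x $ i))) s
      (\<lambda>x. psi_spikes A 2 (x $ i))"
    unfolding sum_s by simp
  \<comment> \<open>Both sides come from the same integral against the second derivative of the test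
    function. Apart from its membership in \<open>Lp_fun\<close>, this is all that enters about
    \<open>v\<close>.\<close>
  have test_eq: "(LINT x|lebesgue. psi_spikes A 2 (x $ i) * \<phi> x) = (LINT x|lebesgue. v x * \<phi> x)"
    if "test_function \<phi>" for \<phi>
    using v_deriv classical that unfolding has_weak_deriv_def sum_s by simp

  define r :: "real ^ 'd \<Rightarrow> real" where "r x = exp (log_density \<theta> C x)" for x
  define V where "V = (LINT x|lebesgue. r x * \<bar>v x\<bar> powr p)"
  have "v \<in> borel_measurable lebesgue"
    using v by (simp add: Lp_fun_def reference_measure_def)
  then have V_int: "integrable lebesgue (\<lambda>x. r x * \<bar>v x\<bar> powr p)"
    using v integrable_reference_measure_iff[OF \<theta>(2), of "\<lambda>x. \<bar>v x\<bar> powr p" C]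
    by (simp add: Lp_fun_def r_def)

  obtain \<delta> \<kappa> L :: real where \<delta>: "0 < \<delta>" "\<delta> \<le> 1 / 4" and \<kappa>: "0 < \<kappa>" and L: "1 \<le> L"
    and lower: "\<And>n y. L \<le> A n \<Longrightarrow> real n + 1 / 2 \<le> y \<Longrightarrow> y \<le> real n + 1 / 2 + \<delta> / A n \<Longrightarrow>
       \<kappa> * (A n)\<^sup>2 \<le> psi_spikes A 2 y"
    using psi_spikes_2_lower_bound by metis
  define J where "J = integral\<^sup>L lborel bump"
  have J: "J > 0" using integral_bump by (simp add: J_def)
  define w where "w z = exp (C - \<theta> z)" for z
  \<comment> \<open>Collects the factors independent of n: the power of \<kappa> / 2 from M^p,
    \<delta> and J from the integral of the test function, and the weights of the remaining
    coordinates, which range over the unit interval.\<close>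
  define c where "c = (\<kappa> / 2) powr p * \<delta> * J ^ CARD('d) * w 1 ^ CARD('d) / w 1"
  have c: "c > 0"
    using \<kappa> \<delta> J by (simp add: c_def w_def)

  have bound: "c * (A n powr (2 * p - 1) * w (real (Suc n))) \<le> V" if An: "L \<le> A n" for n
  proof -
    define a where "a = A n"
    have a: "a \<ge> 1" using An L by (simp add: a_def)
    \<comment> \<open>In direction \<open>i\<close> the bump is squeezed onto the window of length
      \<delta> / a that starts at the crossing; the other directions keep the unit bump.\<close>
    define f where "f j = (if j = i then (\<lambda>y. bump (a / \<delta> * y + - (a / \<delta> * (real n + 1 / 2)))) else bump)"
      for j
    define \<phi> :: "real ^ 'd \<Rightarrow> real" where "\<phi> x = (\<Prod>j\<in>UNIV. f j (x $ j))" for x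
    have f_smooth: "smooth_real (f j)" for j
      by (cases "j = i") (simp_all only: f_def simp_thms if_True if_False smooth_real_bump
          smooth_real_affine[OF smooth_real_bump])
    have f_nonneg: "f j y \<ge> 0" and f_le_1: "f j y \<le> 1" for j y
      using bump_nonneg bump_le_1 by (auto simp: f_def)
    define l where "l j = (if j = i then real n + 1 / 2 else 0)" for j
    define u where "u j = (if j = i then real n + 1 / 2 + \<delta> / a else 1)" for j
    have f_supp: "l j \<le> y \<and> y \<le> u j" if "f j y \<noteq> 0" for j y
    proof (cases "j = i")
      case True
      then have "f j y = bump (a / \<delta> * (y - (real n + 1 / 2)))"
        unfolding f_def by (simp only: right_diff_distrib simp_thms if_True) simp
      moreover define z where "z = y - (real n + 1 / 2)"
      ultimately have "0 < a / \<delta> * z" "a / \<delta> * z < 1"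
        using that bump_nonzeroD by auto
      then have "0 < z" "z < \<delta> / a"
        using a \<delta> by (simp_all add: zero_less_divide_iff zero_less_mult_iff field_simps)
      then show ?thesis
        using True by (simp add: l_def u_def z_def)
    next
      case False
      then show ?thesis using that bump_nonzeroD[of y] by (simp add: f_def l_def u_def)
    qed
    have \<phi>_test: "test_function \<phi>"
      unfolding \<phi>_def by (rule test_function_prod[where l = l and u = u]) (fact f_smooth f_supp)+
    have \<phi>_nonneg: "\<phi> x \<ge> 0" and \<phi>_le_1: "\<phi> x \<le> 1" for x
      using f_nonneg f_le_1 by (auto simp: \<phi>_def intro!: prod_nonneg prod_le_1)
    have \<phi>_supp: "l j \<le> x $ j \<and> x $ j \<le> u j" if "\<phi> x \<noteq> 0" for x j
      using that by (intro f_supp) (auto simp: \<phi>_def)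

    have f_int: "integrable lborel (f j)" "integral\<^sup>L lborel (f j) = (if j = i then \<delta> / a else 1) * J" for j
    proof -
      have "\<delta> / a \<noteq> 0" using a \<delta> by simp
      have f_other: "f j = bump" if "j \<noteq> i" for j
        using that by (simp add: f_def)
      have eq: "f i (real n + 1 / 2 + \<delta> / a * y) = bump y" for y
        using a \<delta> by (simp add: f_def field_simps)
      have "integrable lborel (f i)"
        using lborel_integrable_real_affine_iff[OF \<open>\<delta> / a \<noteq> 0\<close>, of "f i" "real n + 1 / 2"]
          integral_bump(1) by (simp only: eq)
      moreover have "integral\<^sup>L lborel (f i) = \<delta> / a * J"
        using lborel_integral_real_affine[OF \<open>\<delta> / a \<noteq> 0\<close>, of "f i" "real n + 1 / 2"] a \<delta>
        by (simp only: eq J_def) simp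
      ultimately show "integrable lborel (f j)"
          "integral\<^sup>L lborel (f j) = (if j = i then \<delta> / a else 1) * J"
        using integral_bump(1) f_other[of j] by (cases "j = i"; simp add: J_def)+
    qed
    have \<phi>_int: "integrable lborel \<phi>"
      using integrable_mult_test[OF _ \<phi>_test, of "\<lambda>x. 1"] by simp
    have "integral\<^sup>L lborel \<phi> = (\<Prod>j\<in>UNIV. (if j = i then \<delta> / a else 1) * J)"
      unfolding \<phi>_def using integral_prod_coordinates[of f] f_int f_nonneg by simp
    then have \<phi>_integral: "integral\<^sup>L lborel \<phi> = \<delta> / a * J ^ CARD('d)"
      by (simp add: prod.distrib)

    \<comment> \<open>A lower bound for the density on the support of the test function, taken at
      the right ends n + 1 and 1 of the coordinate ranges. Dividing by \<open>w 1\<close> in one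
      factor turns the product into a full power of \<open>w 1\<close>.\<close>
    define \<rho> where "\<rho> = (\<Prod>j\<in>UNIV. (if j = i then w (real (Suc n)) / w 1 else 1) * w 1)"
    have \<rho>: "\<rho> = w (real (Suc n)) / w 1 * w 1 ^ CARD('d)"
      by (simp add: \<rho>_def prod.distrib)
    have \<rho>_pos: "\<rho> > 0" by (simp add: \<rho> w_def)
    have \<rho>_le: "\<rho> \<le> r x" if "\<phi> x \<noteq> 0" for x
      unfolding \<rho>_def r_def exp_log_density
    proof (intro prod_mono conjI)
      fix j
      have "\<delta> / a \<le> \<delta>" using a \<delta> by (simp add: divide_le_eq)
      then have "0 \<le> x $ j" "x $ j \<le> (if j = i then real (Suc n) else 1)"
        using \<phi>_supp[OF that, of j] \<delta> by (auto simp: l_def u_def split: if_splits)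
      then have "\<theta> \<bar>x $ j\<bar> \<le> \<theta> (if j = i then real (Suc n) else 1)"
        by (intro mono_onD[OF \<theta>(1)]) auto
      moreover have "(if j = i then w (real (Suc n)) / w 1 else 1) * w 1 =
          exp (C - \<theta> (if j = i then real (Suc n) else 1))"
        by (simp add: w_def)
      ultimately show "(if j = i then w (real (Suc n)) / w 1 else 1) * w 1 \<le> exp (C - \<theta> \<bar>x $ j\<bar>)"
        by simp
    qed (simp add: w_def)

    \<comment> \<open>Half of the pointwise lower bound for the second derivative. The part of
      \<open>v\<close> below the threshold \<open>M\<close> then accounts for only half of the
      tested integral, and the other half must come from the p-th power of \<open>v\<close>.\<close>
    define M where "M = \<kappa> * a\<^sup>2 / 2"
    have M: "M > 0" using \<kappa> a by (simp add: M_def)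
    define T where "T = M powr (1 - p) / \<rho>"
    have cont: "continuous_on UNIV (\<lambda>x::real^'d. psi_spikes A 2 (x $ i))"
      by (rule continuous_on_compose2[OF continuous_on_psi_spikes_2[of UNIV]])
        (auto intro!: continuous_intros)
    have "2 * M * integral\<^sup>L lborel \<phi> = (\<integral>x. 2 * M * \<phi> x \<partial>lborel)"
      by simp
    also have "\<dots> \<le> (\<integral>x. psi_spikes A 2 (x $ i) * \<phi> x \<partial>lborel)"
    proof (rule integral_mono)
      show "2 * M * \<phi> x \<le> psi_spikes A 2 (x $ i) * \<phi> x" for x
      proof (cases "\<phi> x = 0")
        case False
        have "2 * M \<le> psi_spikes A 2 (x $ i)"
          using lower[OF An, of "x $ i"] \<phi>_supp[OF False, of i] by (simp add: M_def a_def l_def u_def)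
        then show ?thesis using \<phi>_nonneg by (rule mult_right_mono)
      qed simp
    qed (use \<phi>_int integrable_mult_test[OF cont \<phi>_test] in auto)
    also have "\<dots> = (LINT x|lebesgue. psi_spikes A 2 (x $ i) * \<phi> x)"
      using borel_measurable_integrable[OF integrable_mult_test[OF cont \<phi>_test]]
      by (intro integral_completion[symmetric])
    also have "\<dots> = (LINT x|lebesgue. v x * \<phi> x)"
      by (rule test_eq[OF \<phi>_test])
    also have "\<dots> \<le> (LINT x|lebesgue. M * \<phi> x + T * (r x * \<bar>v x\<bar> powr p))"
    proof (rule integral_mono')
      show "v x * \<phi> x \<le> M * \<phi> x + T * (r x * \<bar>v x\<bar> powr p)" for x
        unfolding T_def
        by (rule weighted_Chebyshev) (use \<phi>_nonneg \<phi>_le_1 M p \<rho>_pos \<rho>_le in \<open>auto simp: r_def\<close>)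
      show "0 \<le> M * \<phi> x + T * (r x * \<bar>v x\<bar> powr p)" for x
        using M \<rho>_pos \<phi>_nonneg by (simp add: T_def r_def)
      show "integrable lebesgue (\<lambda>x. M * \<phi> x + T * (r x * \<bar>v x\<bar> powr p))"
        using V_int \<phi>_int borel_measurable_integrable[OF \<phi>_int] by (simp add: integrable_completion)
    qed
    also have "\<dots> = M * integral\<^sup>L lborel \<phi> + T * V"
      using V_int \<phi>_int borel_measurable_integrable[OF \<phi>_int]
      by (simp add: integrable_completion integral_completion V_def)
    finally have "M * integral\<^sup>L lborel \<phi> \<le> T * V"
      by simp
    then have "M powr (p - 1) * \<rho> * (M * integral\<^sup>L lborel \<phi>) \<le> M powr (p - 1) * \<rho> * (T * V)"
      using \<rho>_pos by (intro mult_left_mono) auto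
    also have "\<dots> = V"
      using M \<rho>_pos by (simp add: T_def powr_diff)
    finally have "M powr (p - 1) * M * \<rho> * integral\<^sup>L lborel \<phi> \<le> V"
      by (simp add: mult_ac)
    \<comment> \<open>As M is of order a^2, its p-th power is of order a^(2p). One factor
      \<open>a\<close> is split off to cancel against the window length \<delta> / a, which leaves
      the exponent 2p - 1.\<close>
    moreover have "M powr (p - 1) * M = (\<kappa> / 2) powr p * (a powr (2 * p - 1) * a)"
    proof -
      have "M powr (p - 1) * M = M powr p"
        using M by (simp add: powr_diff)
      also have "\<dots> = (\<kappa> / 2 * a powr 2) powr p"
        using a by (simp add: M_def)
      also have "\<dots> = (\<kappa> / 2) powr p * a powr (2 * p)"
        using \<kappa> by (subst powr_mult) (auto simp: powr_powr)
      also have "a powr (2 * p) = a powr (2 * p - 1) * a"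
        using a by (simp add: powr_diff)
      finally show ?thesis .
    qed
    ultimately have "(\<kappa> / 2) powr p * (a powr (2 * p - 1) * a) * \<rho> * integral\<^sup>L lborel \<phi> \<le> V"
      by simp
    moreover have "(\<kappa> / 2) powr p * (a powr (2 * p - 1) * a) * \<rho> * integral\<^sup>L lborel \<phi> =
        c * (A n powr (2 * p - 1) * w (real (Suc n)))"
      using a unfolding \<phi>_integral \<rho> c_def a_def[symmetric] by simp
    ultimately show ?thesis
      by simp
  qed

  have "\<forall>\<^sub>F n in sequentially. L \<le> A n \<and> V / c + 1 \<le> A n powr (2 * p - 1) * exp (C - \<theta> (real (Suc n)))"
    using A unfolding filterlim_at_top by (intro eventually_conj) auto
  then obtain n where n: "L \<le> A n" "V / c + 1 \<le> A n powr (2 * p - 1) * w (real (Suc n))"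
    unfolding w_def using eventually_happens'[OF sequentially_bot] by blast
  have "V < c * (V / c + 1)"
    using c by (simp add: field_simps)
  also have "\<dots> \<le> c * (A n powr (2 * p - 1) * w (real (Suc n)))"
    using c n by (intro mult_left_mono) auto
  also have "\<dots> \<le> V"
    by (rule bound[OF n(1)])
  finally show False by simp
qed

text \<open>Every derivative is a spike train with the same heights and a bounded profile, so a
  single summability condition serves all orders at once.\<close>

lemma spikes_sobolev:
  fixes \<theta> :: "real \<Rightarrow> real" and i :: "'d::finite"
  assumes \<theta>: "mono_on {0..} \<theta>" "(\<lambda>z. \<theta> \<bar>z\<bar>) \<in> borel_measurable borel" and p: "0 < p"
    and fin: "(\<integral>\<^sup>+z. ennreal (exp (C - \<theta> \<bar>z\<bar>)) \<partial>lborel) < \<infinity>"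
    and A: "\<And>n. 0 \<le> A n" "summable (\<lambda>n. A n powr p * exp (C - \<theta> (real n)))"
  shows "(\<lambda>x. spike_train A spike (x $ i)) \<in> sobolev k p (reference_measure \<theta> C :: (real ^ 'd) measure)"
proof -
  have Lp: "(\<lambda>x. spikes A m (x $ i)) \<in> Lp_fun p (reference_measure \<theta> C :: (real ^ 'd) measure)" for m
  proof (rule coordinate_in_Lp[OF \<theta>(2) _ fin])
    show "spikes A m \<in> borel_measurable borel"
      by (rule borel_measurable_continuous_onI[OF continuous_on_spikes])
    have vanish: "(deriv ^^ m) spike x = 0" if "x \<le> 0 \<or> 1 \<le> x" for x
      by (rule funpow_deriv_vanish_outside[OF smooth_real_spike spike_eq_0 that])
    obtain B where "\<And>x. \<bar>(deriv ^^ m) spike x\<bar> \<le> B"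
      using smooth_unit_support_bounded[OF smooth_real_funpow_deriv[OF smooth_real_spike] vanish] by blast
    then have "(\<integral>\<^sup>+z. ennreal (\<bar>spikes A m z\<bar> powr p * (\<lambda>z. exp (C - \<theta> \<bar>z\<bar>)) \<bar>z\<bar>) \<partial>lborel) < \<infinity>"
      using \<theta>(1) p A vanish by (intro nn_integral_spike_train_finite) (auto simp: mono_on_def)
    then show "(\<integral>\<^sup>+z. ennreal (\<bar>spikes A m z\<bar> powr p * exp (C - \<theta> \<bar>z\<bar>)) \<partial>lborel) < \<infinity>"
      by simp
  qed
  moreover have zero: "(\<lambda>x. 0) \<in> Lp_fun p (reference_measure \<theta> C :: (real ^ 'd) measure)"
    by (simp add: Lp_fun_def)
  have "\<exists>v\<in>Lp_fun p (reference_measure \<theta> C :: (real ^ 'd) measure).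
      has_weak_deriv (\<lambda>x. spikes A 0 (x $ i)) s v" for s
  proof (rule bexI)
    show "has_weak_deriv (\<lambda>x. spikes A 0 (x $ i)) s
      (\<lambda>x. if \<forall>j. j \<noteq> i \<longrightarrow> s j = 0 then spikes A (\<Sum>j\<in>UNIV. s j) (x $ i) else 0)"
      by (rule has_weak_deriv_coordinate[where N = "\<Sum>j\<in>UNIV. s j"])
        (auto intro: spikes_derivative continuous_on_spikes simp del: funpow.simps)
    have "(\<lambda>x. if P then spikes A m (x $ i) else 0) \<in> Lp_fun p (reference_measure \<theta> C :: (real ^ 'd) measure)"
      for P m using Lp[of m] zero by (cases P) simp_all
    then show "(\<lambda>x. if \<forall>j. j \<noteq> i \<longrightarrow> s j = 0 then spikes A (\<Sum>j\<in>UNIV. s j) (x $ i) else 0)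
      \<in> Lp_fun p (reference_measure \<theta> C :: (real ^ 'd) measure)" .
  qed
  ultimately show ?thesis
    using Lp[of 0] unfolding sobolev_def by simp
qed

lemma spike_height_at_top:
  fixes t p K :: real
  assumes "0 < t" "0 < p"
  shows "filterlim (\<lambda>n. exp ((real n powr t + K - 2 * ln (real n + 1)) / p)) at_top sequentially"
  using assms by real_asymp

text \<open>(n + 1)^t / n^t tends to 1, so the surplus e * n^t outweighs both the shift by one and
  the logarithm.\<close>

lemma spike_energy_at_top:
  fixes t e K K' :: real
  assumes "0 < t" "0 < e"
  shows "filterlim (\<lambda>n. exp ((1 + e) * (real n powr t + K - 2 * ln (real n + 1)) + K'
     - (real n + 1) powr t)) at_top sequentially"
  using assms by real_asymp

theorem proposition3:
  fixes t c z\<^sub>t C p :: real and \<theta> :: "real \<Rightarrow> real" and k :: nat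
  assumes "0 < t" and "t \<le> 2"
    and "0 \<le> z\<^sub>t"
    and "admissible_theta t c z\<^sub>t \<theta>"
    and "has_bochner_integral lebesgue (\<lambda>z. exp (C - \<theta> \<bar>z\<bar>)) 1"
    and "1 < p" and "2 \<le> k"
  shows "\<exists>a \<in> sobolev k p (reference_measure \<theta> C :: (real ^ 'd) measure).
           (\<lambda>x. psi (a x)) \<notin> sobolev k p (reference_measure \<theta> C)"
proof -
  define w where "w n = exp (C - \<theta> (real n))" for n
  \<comment> \<open>Solved from A(n)^p * w(n) = (n + 1)^(-2), so that the energies of the spikes
    form a convergent series.\<close>
  define A where "A n = (w n * (real n + 1)\<^sup>2) powr (- 1 / p)" for n
  have mono: "mono_on {0..} \<theta>"
    using assms(4) strict_mono_on_imp_mono_on unfolding admissible_theta_def by blast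
  \<comment> \<open>Differentiability is given on the open half-line, so 0 remains as one
    exceptional point, which Borel measurability tolerates.\<close>
  have "continuous_on (- {0}) (\<lambda>z. \<theta> \<bar>z\<bar>)"
  proof (intro continuous_at_imp_continuous_on ballI)
    fix z :: real assume "z \<in> - {0}"
    then have "\<bar>z\<bar> > 0" by simp
    then have "\<theta> differentiable (at \<bar>z\<bar>)"
      using assms(4) unfolding admissible_theta_def by blast
    then have "isCont \<theta> \<bar>z\<bar>"
      by (rule differentiable_imp_continuous_within)
    then show "isCont (\<lambda>z. \<theta> \<bar>z\<bar>) z"
      by (intro isCont_o2[where f = abs and g = \<theta>]) auto
  qed
  then have borel: "(\<lambda>z. \<theta> \<bar>z\<bar>) \<in> borel_measurable borel"
    by (rule borel_measurable_continuous_countable_exceptions[rotated]) auto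
  have "(\<integral>\<^sup>+z. ennreal (exp (C - \<theta> \<bar>z\<bar>)) \<partial>lborel) = (\<integral>\<^sup>+z. ennreal (exp (C - \<theta> \<bar>z\<bar>)) \<partial>lebesgue)"
    by (simp add: nn_integral_completion)
  also have "\<dots> = ennreal 1"
    using assms(5) by (subst nn_integral_eq_integral) (auto simp: has_bochner_integral_iff)
  finally have fin: "(\<integral>\<^sup>+z. ennreal (exp (C - \<theta> \<bar>z\<bar>)) \<partial>lborel) < \<infinity>"
    by simp

  have "A n powr p * w n = inverse ((real n + 1)\<^sup>2)" for n
  proof -
    have "A n powr p = (w n * (real n + 1)\<^sup>2) powr - 1"
      using \<open>1 < p\<close> unfolding A_def powr_powr by simp
    also have "\<dots> = inverse (w n * (real n + 1)\<^sup>2)"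
      by (simp add: powr_minus w_def)
    finally show ?thesis
      by (simp add: w_def)
  qed
  moreover have "summable (\<lambda>n. inverse ((real n + 1)\<^sup>2))"
    using summable_Suc_iff[of "\<lambda>n. inverse (real n ^ 2)"] inverse_power_summable[of 2, where 'a = real]
    by (simp add: add.commute)
  ultimately have summable: "summable (\<lambda>n. A n powr p * exp (C - \<theta> (real n)))"
    by (simp add: w_def)

  have \<theta>_tail: "\<forall>\<^sub>F n in sequentially. \<theta> (real n) = c + real n powr t"
    using eventually_ge_at_top[of "nat \<lceil>z\<^sub>t\<rceil> + 1"]
  proof eventually_elim
    case (elim n)
    then have "z\<^sub>t \<le> real n" "0 < real n" by linarith+
    then show ?case using assms(4) unfolding admissible_theta_def by blast
  qed
  have A_tail: "\<forall>\<^sub>F n in sequentially.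
      A n = exp ((real n powr t + (c - C) - 2 * ln (real n + 1)) / p)"
    using \<theta>_tail
  proof eventually_elim
    case (elim n)
    have "ln (w n * (real n + 1)\<^sup>2) = C - c - real n powr t + 2 * ln (real n + 1)"
      by (simp add: w_def elim ln_mult ln_realpow)
    moreover have "w n * (real n + 1)\<^sup>2 \<noteq> 0"
      by (simp add: w_def)
    ultimately have "A n = exp (- 1 / p * (C - c - real n powr t + 2 * ln (real n + 1)))"
      unfolding A_def powr_def[of "w n * (real n + 1)\<^sup>2"] by simp
    also have "- 1 / p * (C - c - real n powr t + 2 * ln (real n + 1)) =
        (real n powr t + (c - C) - 2 * ln (real n + 1)) / p"
      using \<open>1 < p\<close> by (simp add: field_simps)
    finally show ?case .
  qed
  have A_lim: "filterlim A at_top sequentially"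
    using spike_height_at_top[of t p "c - C"] assms(1,6) A_tail by (simp add: filterlim_cong)
  \<comment> \<open>Since A(n) is of order w(n)^(-1/p) up to a power of n, the exponent 2p - 1
    yields w(n) to the power -(2p - 1) / p = -(1 + e).\<close>
  define e where "e = (p - 1) / p"
  have e: "e > 0" using \<open>1 < p\<close> by (simp add: e_def)
  have "\<forall>\<^sub>F n in sequentially. A n powr (2 * p - 1) * exp (C - \<theta> (real (Suc n))) =
      exp ((1 + e) * (real n powr t + (c - C) - 2 * ln (real n + 1)) + (C - c) - (real n + 1) powr t)"
    using A_tail \<theta>_tail[THEN eventually_sequentially_Suc[THEN iffD2]]
  proof eventually_elim
    case (elim n)
    have "2 * p - 1 = (1 + e) * p"
      using \<open>1 < p\<close> by (simp add: e_def field_simps)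
    then have "A n powr (2 * p - 1) = exp ((1 + e) * (real n powr t + (c - C) - 2 * ln (real n + 1)))"
      using \<open>1 < p\<close> unfolding elim(1) by (simp add: powr_def)
    then show ?case
      unfolding elim(2) by (simp flip: exp_add add: algebra_simps)
  qed
  then have "filterlim (\<lambda>n. A n powr (2 * p - 1) * exp (C - \<theta> (real (Suc n)))) at_top sequentially"
    using spike_energy_at_top[OF assms(1) e] by (simp add: filterlim_cong)
  \<comment> \<open>Any fixed coordinate will do; \<open>undefined\<close> names one.\<close>
  then have not_sobolev: "(\<lambda>x. psi (spike_train A spike (x $ (undefined :: 'd))))
      \<notin> sobolev k p (reference_measure \<theta> C :: (real ^ 'd) measure)"
    by (intro psi_spikes_not_sobolev mono borel A_lim assms(6,7))
  have "(\<lambda>x. spike_train A spike (x $ (undefined :: 'd)))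
      \<in> sobolev k p (reference_measure \<theta> C :: (real ^ 'd) measure)"
    using assms(6) by (intro spikes_sobolev mono borel fin summable) (auto simp: A_def)
  then show ?thesis
    by (rule bexI[rotated]) (rule not_sobolev)
qed

end
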